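(* Let $n\ge2$ and let $g$ be the left-invariant Hermitian metric on $\mathsf{SL}_{n+1}(\mathbb C)$ induced by the inner product $\langle\sigma_{x_0,y_0,z_0}\cdot,\cdot\rangle$ on $\mathfrak{sl}_{n+1}(\mathbb C)$ for some $x_0,y_0,z_0>0$. Then the unique left-invariant solution $(g_t)_{t\in[0,T_{\max})}$ of the Positive Hermitian Curvature Flow with $g_0=g$ is induced by $\langle\sigma_{x(t),y(t),z(t)}\cdot,\cdot\rangle$, where $(x,y,z):[0,T_{\max})\to\mathbb R^3_{>0}$ is a smooth solution of \[\dot x=nx^2+z^2,\quad \dot y=(n+1)z^2,\quad \dot z=\tfrac{n+1}{n}z\big((n-1)x+y\big),\qquad (x,y,z)(0)=(x_0,y_0,z_0).\]
   Context: $\langle X,Y\rangle=\operatorname{tr}(XY^* )$ on $\mathfrak{sl}_{n+1}(\mathbb C)$; $\mathfrak{sl}_n(\mathbb C)$ is embedded as the upper-left block, $I=\sqrt{\tfrac1{n(n+1)}}\operatorname{diag}(1,\dots,1,-n)$, $\mathfrak s=\operatorname{span}_{\mathbb C}\{e_{i(n+1)},e_{(n+1)i}\}_{i=1}^n$, and $\sigma_{x,y,z}=x^{-1}\mathrm{id}_{\mathfrak{sl}_n(\mathbb C)}+y^{-1}\mathrm{id}_{\mathbb CI}+z^{-1}\mathrm{id}_{\mathfrak s}$. The Positive Hermitian Curvature Flow is $\partial_tg_t=-\Theta(g_t)$, where for a left-invariant Hermitian metric $g$ on a complex Lie group $\Theta(g)=g(P\cdot,\cdot)$ with $P$ the $g_e$-Hermitian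 endomorphism of the Lie algebra satisfying $g_e(PX,X)=\sum_{i<j}|g_e([e_i,e_j],X)|^2$ for a $g_e$-unitary complex basis $\{e_i\}$. *)

theory Defs
  imports "HOL-Analysis.Analysis" "HOL-Library.Extended_Real"
begin

text \<open>Complex matrices are represented as functions nat => nat => complex;
  an N x N matrix is one whose entries vanish outside the index range 0..N-1.
  The Lie algebra sl_{n+1}(C) uses indices 0..n, so the last index n plays the
  role of the paper's index n+1.\<close>

type_synonym cmat = "nat \<Rightarrow> nat \<Rightarrow> complex"

definition mat_space :: "nat \<Rightarrow> cmat set" where
  "mat_space N = {M. \<forall>i j. (N \<le> i \<or> N \<le> j) \<longrightarrow> M i j = 0}"

definition sl :: "nat \<Rightarrow> cmat set" where
  "sl N = {M \<in> mat_space N. (\<Sum>i<N. M i i) = 0}"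

definition mzero :: cmat where "mzero = (\<lambda>i j. 0)"

definition madd :: "cmat \<Rightarrow> cmat \<Rightarrow> cmat" where
  "madd X Y = (\<lambda>i j. X i j + Y i j)"

definition msub :: "cmat \<Rightarrow> cmat \<Rightarrow> cmat" where
  "msub X Y = (\<lambda>i j. X i j - Y i j)"

definition smul :: "complex \<Rightarrow> cmat \<Rightarrow> cmat" where
  "smul c X = (\<lambda>i j. c * X i j)"

definition bracket :: "nat \<Rightarrow> cmat \<Rightarrow> cmat \<Rightarrow> cmat" where
  "bracket N X Y = (\<lambda>a b. if a < N \<and> b < N
      then (\<Sum>k<N. X a k * Y k b - Y a k * X k b) else 0)"

definition tr_inner :: "nat \<Rightarrow> cmat \<Rightarrow> cmat \<Rightarrow> complex" where
  "tr_inner N X Y = (\<Sum>i<N. \<Sum>j<N. X i j * cnj (Y i j))"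

definition herm_inner :: "nat \<Rightarrow> (cmat \<Rightarrow> cmat \<Rightarrow> complex) \<Rightarrow> bool" where
  "herm_inner N h \<longleftrightarrow>
     (\<forall>X\<in>sl N. \<forall>Y\<in>sl N. \<forall>Z\<in>sl N. h (madd X Y) Z = h X Z + h Y Z) \<and>
     (\<forall>c. \<forall>X\<in>sl N. \<forall>Y\<in>sl N. h (smul c X) Y = c * h X Y) \<and>
     (\<forall>X\<in>sl N. \<forall>Y\<in>sl N. h Y X = cnj (h X Y)) \<and>
     (\<forall>X\<in>sl N. X \<noteq> mzero \<longrightarrow> 0 < Re (h X X))"

definition unitary_basis :: "nat \<Rightarrow> (cmat \<Rightarrow> cmat \<Rightarrow> complex) \<Rightarrow> nat \<Rightarrow> (nat \<Rightarrow> cmat) \<Rightarrow> bool" where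
  "unitary_basis N h d e \<longleftrightarrow>
     (\<forall>i<d. e i \<in> sl N) \<and>
     (\<forall>i<d. \<forall>j<d. h (e i) (e j) = (if i = j then 1 else 0)) \<and>
     (\<forall>X\<in>sl N. \<exists>c. X = (\<lambda>a b. \<Sum>i<d. c i * e i a b))"

text \<open>P is the h-Hermitian endomorphism of sl_N with
  h(PX,X) = sum_{i<j} |h([e_i,e_j],X)|^2 for h-unitary bases (P is set to 0
  outside sl_N, to make it unique as a function).\<close>
definition is_P :: "nat \<Rightarrow> (cmat \<Rightarrow> cmat \<Rightarrow> complex) \<Rightarrow> (cmat \<Rightarrow> cmat) \<Rightarrow> bool" where
  "is_P N h P \<longleftrightarrow>
     (\<forall>X. X \<notin> sl N \<longrightarrow> P X = mzero) \<and>
     (\<forall>X\<in>sl N. P X \<in> sl N) \<and>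
     (\<forall>X\<in>sl N. \<forall>Y\<in>sl N. P (madd X Y) = madd (P X) (P Y)) \<and>
     (\<forall>c. \<forall>X\<in>sl N. P (smul c X) = smul c (P X)) \<and>
     (\<forall>X\<in>sl N. \<forall>Y\<in>sl N. h (P X) Y = h X (P Y)) \<and>
     (\<forall>d e. unitary_basis N h d e \<longrightarrow>
        (\<forall>X\<in>sl N. h (P X) X =
           complex_of_real (\<Sum>(i,j)\<in>{(i,j). i < j \<and> j < d}.
              (cmod (h (bracket N (e i) (e j)) X))\<^sup>2)))"

definition Theta :: "nat \<Rightarrow> (cmat \<Rightarrow> cmat \<Rightarrow> complex) \<Rightarrow> cmat \<Rightarrow> cmat \<Rightarrow> complex" where
  "Theta N h = (\<lambda>X Y. h ((THE P. is_P N h P) X) Y)"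

definition Imat :: "nat \<Rightarrow> cmat" where
  "Imat n = (\<lambda>i j. let c = complex_of_real (sqrt (1 / (real n * (real n + 1)))) in
      if i = j \<and> i < n then c else if i = j \<and> i = n then - of_nat n * c else 0)"

text \<open>Projections for sl_{n+1} = sl_n (upper left block) + C I + s.\<close>
definition proj_s :: "nat \<Rightarrow> cmat \<Rightarrow> cmat" where
  "proj_s n X = (\<lambda>i j. if (i < n \<and> j = n) \<or> (i = n \<and> j < n) then X i j else 0)"

definition proj_I :: "nat \<Rightarrow> cmat \<Rightarrow> cmat" where
  "proj_I n X = smul (tr_inner (Suc n) X (Imat n)) (Imat n)"

definition proj_sln :: "nat \<Rightarrow> cmat \<Rightarrow> cmat" where
  "proj_sln n X = msub (msub X (proj_s n X)) (proj_I n X)"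

definition sigma :: "nat \<Rightarrow> real \<Rightarrow> real \<Rightarrow> real \<Rightarrow> cmat \<Rightarrow> cmat" where
  "sigma n x y z X = madd (smul (complex_of_real (1 / x)) (proj_sln n X))
      (madd (smul (complex_of_real (1 / y)) (proj_I n X))
            (smul (complex_of_real (1 / z)) (proj_s n X)))"

definition sigma_metric :: "nat \<Rightarrow> real \<Rightarrow> real \<Rightarrow> real \<Rightarrow> cmat \<Rightarrow> cmat \<Rightarrow> complex" where
  "sigma_metric n x y z X Y = tr_inner (Suc n) (sigma n x y z X) Y"

definition smooth_real_on :: "real set \<Rightarrow> (real \<Rightarrow> real) \<Rightarrow> bool" where
  "smooth_real_on S f \<longleftrightarrow> (\<exists>D. D 0 = f \<and>
     (\<forall>k. \<forall>t\<in>S. (D k has_real_derivative D (Suc k) t) (at t within S)))"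

end

theory Submission
  imports Defs
begin

text \<open>
  Call a family \<open>e\<^sub>i\<close> with real weights \<open>w\<^sub>i\<close> a frame of a Hermitian form \<open>h\<close> if
  \<open>X = \<Sum>\<^sub>i w\<^sub>i h(X, e\<^sub>i) e\<^sub>i\<close> for all \<open>X\<close>. Traces of sesquilinear forms do not depend on the frame, and for
  two forms the resolvent identity compares them. So the curvature form can be computed in any frame and is
  locally Lipschitz in the metric. For \<open>\<sigma>\<close> metrics the traceless matrix units form a frame, in which
  the curvature is again a combination of the three invariant forms; this gives the right-hand sides of
  the differential equations.

  No existence theorem for differential equations is needed: given a solution \<open>h\<^sub>t\<close>, read off candidates
  \<open>x\<close>, \<open>y\<close>, \<open>z\<close> from its values on three test vectors and let \<open>k\<^sub>t\<close> be the resulting \<open>\<sigma>\<close> metric.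
  The difference \<open>h\<^sub>t - k\<^sub>t\<close> vanishes at time zero, and its derivative is bounded by a multiple of itself,
  because the curvature of \<open>k\<^sub>t\<close> lies in the span of the three invariant forms. By Gronwall it is zero.
\<close>

text \<open>Write \<Pi> S for the combination of \<open>q0\<close>, \<open>q1\<close>,
  \<open>q2\<close> with coefficients \<open>coef0 S\<close>, \<open>coef1 S\<close>,
  \<open>coef2 S\<close>. Then \<open>k t\<close> is \<Pi> (\<open>h t\<close>), and \<Pi> fixes the
  curvature \<open>kcurv t\<close> of \<open>k t\<close>. With G = \<open>Theta N (h t)\<close> -
  \<open>kcurv t\<close>, the difference \<open>h t\<close> - \<open>k t\<close> has derivative
  \<Pi> G - G. So the motion of \<open>k t\<close>, for which no differential equation is known
  beforehand, enters only through G, and G is bounded by a multiple of the difference. The obstacle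
  is uniformity in time. Each \<open>h t\<close> has a unitary basis, but nothing makes it depend
  continuously on \<open>t\<close>. The comparison of curvatures therefore asks only for bounds on
  the number, the weights and the entries of the frame vectors. For the entries such a bound comes
  from the monotonicity of the metric along the flow. Real weights allow the matrix units to serve
  for \<open>k t\<close> directly, with no orthonormalization of the diagonal.\<close>

definition lincomb :: "'i set \<Rightarrow> ('i \<Rightarrow> complex) \<Rightarrow> ('i \<Rightarrow> cmat) \<Rightarrow> cmat" where
  "lincomb I c e = (\<lambda>a b. \<Sum>i\<in>I. c i * e i a b)"

lemma mzero_sl: "mzero \<in> sl N"
  by (simp add: sl_def mat_space_def mzero_def)

lemma madd_sl: "X \<in> sl N \<Longrightarrow> Y \<in> sl N \<Longrightarrow> madd X Y \<in> sl N"
  by (simp add: sl_def mat_space_def madd_def sum.distrib)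

lemma smul_sl: "X \<in> sl N \<Longrightarrow> smul c X \<in> sl N"
  by (auto simp: sl_def mat_space_def smul_def sum_distrib_left [symmetric])

lemma lincomb_empty: "lincomb {} c e = mzero"
  by (simp add: lincomb_def mzero_def)

lemma lincomb_insert:
  "finite I \<Longrightarrow> i \<notin> I \<Longrightarrow> lincomb (insert i I) c e = madd (smul (c i) (e i)) (lincomb I c e)"
  by (simp add: lincomb_def madd_def smul_def)

lemma lincomb_sl: "finite I \<Longrightarrow> (\<And>i. i \<in> I \<Longrightarrow> e i \<in> sl N) \<Longrightarrow> lincomb I c e \<in> sl N"
  by (induction I rule: finite_induct) (auto simp: lincomb_empty lincomb_insert mzero_sl madd_sl smul_sl)

lemma bracket_sl: "bracket N X Y \<in> sl N"
proof -
  have "(\<Sum>a<N. \<Sum>k<N. X a k * Y k a) = (\<Sum>a<N. \<Sum>k<N. Y a k * X k a)"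
    by (subst sum.swap) (simp add: mult.commute)
  then have "(\<Sum>a<N. bracket N X Y a a) = 0"
    by (simp add: bracket_def sum_subtractf)
  then show ?thesis
    by (auto simp: sl_def mat_space_def bracket_def)
qed

lemma bracket_madd_left: "bracket N (madd X Y) Z = madd (bracket N X Z) (bracket N Y Z)"
  and bracket_madd_right: "bracket N Z (madd X Y) = madd (bracket N Z X) (bracket N Z Y)"
  by (auto simp: bracket_def madd_def fun_eq_iff sum.distrib [symmetric] algebra_simps intro!: sum.cong)

lemma bracket_smul_left: "bracket N (smul c X) Z = smul c (bracket N X Z)"
  and bracket_smul_right: "bracket N Z (smul c X) = smul c (bracket N Z X)"
  by (auto simp: bracket_def smul_def fun_eq_iff sum_distrib_left algebra_simps intro!: sum.cong)

lemma bracket_swap: "bracket N Y X = smul (-1) (bracket N X Y)"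
  by (auto simp: bracket_def smul_def fun_eq_iff sum_negf [symmetric] intro!: sum.cong)

lemma bracket_self: "bracket N X X = mzero"
  by (auto simp: bracket_def mzero_def fun_eq_iff)

section \<open>Entrywise bounds on matrices and their brackets\<close>

definition entries_le :: "real \<Rightarrow> cmat \<Rightarrow> bool" where
  "entries_le C X \<longleftrightarrow> (\<forall>i j. cmod (X i j) \<le> C)"

lemma entries_leD: "entries_le C X \<Longrightarrow> cmod (X i j) \<le> C"
  by (simp add: entries_le_def)

lemma entries_le_nonneg: "entries_le C X \<Longrightarrow> 0 \<le> C"
  using entries_leD norm_ge_zero order_trans by blast

lemma entries_le_bracket:
  assumes X: "entries_le C X" and Y: "entries_le C' Y"
  shows "entries_le (2 * real N * C * C') (bracket N X Y)"
proof -
  note C = entries_le_nonneg [OF X] entries_le_nonneg [OF Y]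
  have p: "cmod (X a b * Y c d) \<le> C * C'" for a b c d
    unfolding norm_mult by (intro mult_mono entries_leD X Y C) auto
  have "cmod (X a k * Y k b - Y a k * X k b) \<le> 2 * C * C'" for a b k
  proof -
    have "cmod (X a k * Y k b - Y a k * X k b) \<le> C * C' + C * C'"
      using p [of a k k b] p [of k b a k] by (intro norm_triangle_le_diff add_mono) (auto simp: mult.commute)
    then show ?thesis by simp
  qed
  then have "cmod (\<Sum>k<N. X a k * Y k b - Y a k * X k b) \<le> (\<Sum>k<N. 2 * C * C')" for a b
    by (intro sum_norm_le) auto
  with C show ?thesis
    by (simp add: entries_le_def bracket_def mult_ac)
qed

section \<open>Sesquilinear and Hermitian forms on \<open>sl N\<close>\<close>

definition sesq :: "nat \<Rightarrow> (cmat \<Rightarrow> cmat \<Rightarrow> complex) \<Rightarrow> bool" where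
  "sesq N S \<longleftrightarrow>
     (\<forall>X\<in>sl N. \<forall>Y\<in>sl N. \<forall>Z\<in>sl N. S (madd X Y) Z = S X Z + S Y Z) \<and>
     (\<forall>c. \<forall>X\<in>sl N. \<forall>Y\<in>sl N. S (smul c X) Y = c * S X Y) \<and>
     (\<forall>X\<in>sl N. \<forall>Y\<in>sl N. \<forall>Z\<in>sl N. S X (madd Y Z) = S X Y + S X Z) \<and>
     (\<forall>c. \<forall>X\<in>sl N. \<forall>Y\<in>sl N. S X (smul c Y) = cnj c * S X Y)"

text \<open>Weaker than \<open>herm_inner\<close>, so that combinations of \<open>q0\<close>,
  \<open>q1\<close>, \<open>q2\<close> with any real coefficients qualify and the comparison of two
  metrics is pure linear algebra.\<close>

definition herm_form :: "nat \<Rightarrow> (cmat \<Rightarrow> cmat \<Rightarrow> complex) \<Rightarrow> bool" where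
  "herm_form N h \<longleftrightarrow> sesq N h \<and> (\<forall>X\<in>sl N. \<forall>Y\<in>sl N. h Y X = cnj (h X Y))"

lemma sesq_madd_left: "sesq N S \<Longrightarrow> X \<in> sl N \<Longrightarrow> Y \<in> sl N \<Longrightarrow> Z \<in> sl N \<Longrightarrow> S (madd X Y) Z = S X Z + S Y Z"
  and sesq_smul_left: "sesq N S \<Longrightarrow> X \<in> sl N \<Longrightarrow> Y \<in> sl N \<Longrightarrow> S (smul c X) Y = c * S X Y"
  and sesq_madd_right: "sesq N S \<Longrightarrow> X \<in> sl N \<Longrightarrow> Y \<in> sl N \<Longrightarrow> Z \<in> sl N \<Longrightarrow> S X (madd Y Z) = S X Y + S X Z"
  and sesq_smul_right: "sesq N S \<Longrightarrow> X \<in> sl N \<Longrightarrow> Y \<in> sl N \<Longrightarrow> S X (smul c Y) = cnj c * S X Y"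
  by (simp_all add: sesq_def)

lemma smul_0: "smul 0 X = mzero"
  by (simp add: smul_def mzero_def)

lemma sesq_mzero_left: "sesq N S \<Longrightarrow> Y \<in> sl N \<Longrightarrow> S mzero Y = 0"
  using sesq_smul_left [of N S mzero Y 0] by (simp add: smul_0 mzero_sl)

lemma sesq_mzero_right: "sesq N S \<Longrightarrow> Y \<in> sl N \<Longrightarrow> S Y mzero = 0"
  using sesq_smul_right [of N S Y mzero 0] by (simp add: smul_0 mzero_sl)

lemma sesq_lincomb_left:
  assumes "sesq N S" "finite I" "\<And>i. i \<in> I \<Longrightarrow> e i \<in> sl N" "Y \<in> sl N"
  shows "S (lincomb I c e) Y = (\<Sum>i\<in>I. c i * S (e i) Y)"
  using assms(2,3)
  by (induction I rule: finite_induct)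
    (auto simp: lincomb_empty lincomb_insert sesq_mzero_left [OF assms(1,4)]
       sesq_madd_left [OF assms(1)] sesq_smul_left [OF assms(1)] assms smul_sl lincomb_sl)

lemma sesq_lincomb_right:
  assumes "sesq N S" "finite I" "\<And>i. i \<in> I \<Longrightarrow> e i \<in> sl N" "Y \<in> sl N"
  shows "S Y (lincomb I c e) = (\<Sum>i\<in>I. cnj (c i) * S Y (e i))"
  using assms(2,3)
  by (induction I rule: finite_induct)
    (auto simp: lincomb_empty lincomb_insert sesq_mzero_right [OF assms(1,4)]
       sesq_madd_right [OF assms(1)] sesq_smul_right [OF assms(1)] assms smul_sl lincomb_sl)

lemma sesq_diff: "sesq N h \<Longrightarrow> sesq N k \<Longrightarrow> sesq N (\<lambda>X Y. h X Y - k X Y)"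
  by (simp add: sesq_def algebra_simps)

lemma herm_form_cnj: "herm_form N h \<Longrightarrow> X \<in> sl N \<Longrightarrow> Y \<in> sl N \<Longrightarrow> cnj (h X Y) = h Y X"
  unfolding herm_form_def by metis

lemma herm_form_sesq: "herm_form N h \<Longrightarrow> sesq N h"
  unfolding herm_form_def by blast

lemma herm_inner_imp_herm_form:
  assumes "herm_inner N h"
  shows "herm_form N h"
proof -
  have a: "h (madd X Y) Z = h X Z + h Y Z" if "X \<in> sl N" "Y \<in> sl N" "Z \<in> sl N" for X Y Z
    using assms that unfolding herm_inner_def by blast
  have s: "h (smul c X) Y = c * h X Y" if "X \<in> sl N" "Y \<in> sl N" for c X Y
    using assms that unfolding herm_inner_def by blast
  have c: "h Y X = cnj (h X Y)" if "X \<in> sl N" "Y \<in> sl N" for X Y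
    using assms that unfolding herm_inner_def by blast
  have "h X (madd Y Z) = h X Y + h X Z" if "X \<in> sl N" "Y \<in> sl N" "Z \<in> sl N" for X Y Z
    using that c [of "madd Y Z" X] c [of Y X] c [of Z X] by (simp add: madd_sl a)
  moreover have "h X (smul d Y) = cnj d * h X Y" if "X \<in> sl N" "Y \<in> sl N" for d X Y
    using that c [of "smul d Y" X] c [of Y X] by (simp add: smul_sl s)
  ultimately show ?thesis
    using a s c unfolding herm_form_def sesq_def by blast
qed

lemma herm_form_self_real: "herm_form N h \<Longrightarrow> X \<in> sl N \<Longrightarrow> h X X = of_real (Re (h X X))"
  using herm_form_cnj [of N h X X] by (simp add: complex_eq_iff)

subsection \<open>Frames\<close>

text \<open>The last clause says that the sum of \<open>w i\<close> times \<open>e i\<close> tensor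
  its conjugate inverts the Gram matrix of \<open>h\<close>. This leaves room for a dependent family
  such as \<open>Eb\<close>, with one member more than the dimension, and for a negative
  weight.\<close>

definition frame :: "nat \<Rightarrow> (cmat \<Rightarrow> cmat \<Rightarrow> complex) \<Rightarrow> 'i set \<Rightarrow> ('i \<Rightarrow> real) \<Rightarrow> ('i \<Rightarrow> cmat) \<Rightarrow> bool" where
  "frame N h I w e \<longleftrightarrow> finite I \<and> (\<forall>i\<in>I. e i \<in> sl N) \<and>
     (\<forall>X\<in>sl N. lincomb I (\<lambda>i. of_real (w i) * h X (e i)) e = X)"

lemma frameD:
  assumes "frame N h I w e"
  shows "finite I" "i \<in> I \<Longrightarrow> e i \<in> sl N"
    "X \<in> sl N \<Longrightarrow> lincomb I (\<lambda>i. of_real (w i) * h X (e i)) e = X"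
  using assms unfolding frame_def by auto

lemma unitary_basis_imp_frame:
  assumes "herm_form N h" "unitary_basis N h d e"
  shows "frame N h {..<d} (\<lambda>_. 1) e"
proof -
  have e: "\<And>i. i \<in> {..<d} \<Longrightarrow> e i \<in> sl N"
    using assms by (auto simp: unitary_basis_def)
  have "lincomb {..<d} (\<lambda>i. of_real 1 * h X (e i)) e = X" if X: "X \<in> sl N" for X
  proof -
    obtain c where c: "X = lincomb {..<d} c e"
      using assms(2) X unfolding unitary_basis_def lincomb_def by blast
    have "h X (e j) = c j" if j: "j < d" for j
    proof -
      have "h X (e j) = (\<Sum>i<d. c i * h (e i) (e j))"
        unfolding c using assms(1) e j by (intro sesq_lincomb_left herm_form_sesq) auto
      also have "\<dots> = (\<Sum>i<d. if i = j then c j else 0)"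
        using assms(2) j by (intro sum.cong) (auto simp: unitary_basis_def)
      finally show ?thesis using j by simp
    qed
    then have "lincomb {..<d} (\<lambda>i. of_real 1 * h X (e i)) e = lincomb {..<d} c e"
      by (auto simp: lincomb_def fun_eq_iff intro!: sum.cong)
    with c show ?thesis by simp
  qed
  with e show ?thesis
    unfolding frame_def by (intro conjI ballI) simp_all
qed

text \<open>The resolvent identity \<open>H\<inverse> - K\<inverse> = H\<inverse> (K - H) K\<inverse>\<close>, traced against \<open>S\<close>.\<close>

lemma frame_trace_diff:
  assumes h: "herm_form N h" "frame N h I w e" and k: "herm_form N k" "frame N k J v f"
    and S: "sesq N S"
  shows "(\<Sum>i\<in>I. of_real (w i) * S (e i) (e i)) - (\<Sum>j\<in>J. of_real (v j) * S (f j) (f j))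
     = (\<Sum>i\<in>I. \<Sum>j\<in>J. of_real (w i) * of_real (v j) * (k (f j) (e i) - h (f j) (e i)) * S (e i) (f j))"
proof -
  note hf = frameD [OF h(2)] and kf = frameD [OF k(2)]
  have 1: "of_real (w i) * S (e i) (e i)
      = (\<Sum>j\<in>J. of_real (w i) * of_real (v j) * k (f j) (e i) * S (e i) (f j))" if i: "i \<in> I" for i
  proof -
    have "S (e i) (e i) = S (e i) (lincomb J (\<lambda>j. of_real (v j) * k (e i) (f j)) f)"
      using kf(3) hf(2) i by simp
    also have "\<dots> = (\<Sum>j\<in>J. cnj (of_real (v j) * k (e i) (f j)) * S (e i) (f j))"
      by (rule sesq_lincomb_right [OF S kf(1,2) hf(2) [OF i]])
    also have "\<dots> = (\<Sum>j\<in>J. of_real (v j) * k (f j) (e i) * S (e i) (f j))"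
      by (intro sum.cong) (auto simp: herm_form_cnj [OF k(1)] kf hf i)
    finally show ?thesis by (simp add: sum_distrib_left mult_ac)
  qed
  have 2: "of_real (v j) * S (f j) (f j)
      = (\<Sum>i\<in>I. of_real (w i) * of_real (v j) * h (f j) (e i) * S (e i) (f j))" if j: "j \<in> J" for j
  proof -
    have "S (f j) (f j) = S (lincomb I (\<lambda>i. of_real (w i) * h (f j) (e i)) e) (f j)"
      using hf(3) kf(2) j by simp
    also have "\<dots> = (\<Sum>i\<in>I. of_real (w i) * h (f j) (e i) * S (e i) (f j))"
      by (rule sesq_lincomb_left [OF S hf(1,2) kf(2) [OF j]])
    finally show ?thesis by (simp add: sum_distrib_left mult_ac)
  qed
  have "(\<Sum>j\<in>J. of_real (v j) * S (f j) (f j))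
     = (\<Sum>j\<in>J. \<Sum>i\<in>I. of_real (w i) * of_real (v j) * h (f j) (e i) * S (e i) (f j))"
    by (intro sum.cong 2) auto
  also have "\<dots> = (\<Sum>i\<in>I. \<Sum>j\<in>J. of_real (w i) * of_real (v j) * h (f j) (e i) * S (e i) (f j))"
    by (rule sum.swap)
  finally show ?thesis
    by (simp add: 1 sum_subtractf [symmetric] algebra_simps)
qed

text \<open>The form \<open>\<Theta>\<close> computed in a frame; the sum runs over ordered pairs, whence the factor one half.\<close>

definition curv :: "nat \<Rightarrow> (cmat \<Rightarrow> cmat \<Rightarrow> complex) \<Rightarrow> 'i set \<Rightarrow> ('i \<Rightarrow> real) \<Rightarrow> ('i \<Rightarrow> cmat)
    \<Rightarrow> cmat \<Rightarrow> cmat \<Rightarrow> complex" where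
  "curv N h I w e X Y = (\<Sum>i\<in>I. \<Sum>j\<in>I. of_real (w i) * of_real (w j) *
      (h X (bracket N (e i) (e j)) * h (bracket N (e i) (e j)) Y)) / 2"

text \<open>\<open>B\<close> sits in the antilinear slot of \<open>h\<close> and \<open>A\<close> in
  the linear one. On the diagonal \<open>A = B\<close> the expression is the summand of
  \<open>curv\<close> with its second index frozen, so \<open>frame_trace_diff\<close> can exchange
  the frame in the first index.\<close>

lemma sesq_bracket_left:
  assumes "sesq N h" "X \<in> sl N" "Y \<in> sl N"
  shows "sesq N (\<lambda>A B. h X (bracket N B C) * h (bracket N A C) Y)"
  using assms by (simp add: sesq_def bracket_madd_left bracket_smul_left bracket_sl algebra_simps)

lemma sesq_bracket_right:
  assumes "sesq N h" "X \<in> sl N" "Y \<in> sl N"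
  shows "sesq N (\<lambda>A B. h X (bracket N C B) * h (bracket N C A) Y)"
  using assms by (simp add: sesq_def bracket_madd_right bracket_smul_right bracket_sl algebra_simps)

text \<open>The frames are exchanged one index at a time, and then the form inside the summand. Each
  exchange leaves a factor \<open>D\<close>. The leading 2 clears the half in
  \<open>curv\<close>.\<close>

lemma curv_diff:
  fixes I :: "'i set" and J :: "'j set"
  assumes h: "herm_form N h" "frame N h I w e" and k: "herm_form N k" "frame N k J v f"
    and X: "X \<in> sl N" and Y: "Y \<in> sl N"
  defines "D \<equiv> \<lambda>X Y. h X Y - k X Y"
  shows "2 * (curv N h I w e X Y - curv N k J v f X Y) =
     - (\<Sum>m\<in>I. \<Sum>i\<in>I. \<Sum>j\<in>J. of_real (w m) * of_real (w i) * of_real (v j) * D (f j) (e i)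
         * (h X (bracket N (f j) (e m)) * h (bracket N (e i) (e m)) Y))
     - (\<Sum>m\<in>J. \<Sum>i\<in>I. \<Sum>j\<in>J. of_real (v m) * of_real (w i) * of_real (v j) * D (f j) (e i)
         * (h X (bracket N (f m) (f j)) * h (bracket N (f m) (e i)) Y))
     + (\<Sum>i\<in>J. \<Sum>j\<in>J. of_real (v i) * of_real (v j) * (D X (bracket N (f i) (f j)) * h (bracket N (f i) (f j)) Y
         + k X (bracket N (f i) (f j)) * D (bracket N (f i) (f j)) Y))"
proof -
  have sh: "sesq N h" using h(1) by (rule herm_form_sesq)
  let ?P = "\<lambda>A B. h X (bracket N A B) * h (bracket N A B) Y"
  let ?w = "\<lambda>i. complex_of_real (w i)" and ?v = "\<lambda>i. complex_of_real (v i)"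
  \<comment> \<open>The first index passes from \<open>e\<close> to \<open>f\<close>, while the
    second stays in the frame of \<open>h\<close>.\<close>
  have 1: "(\<Sum>i\<in>I. \<Sum>m\<in>I. ?w i * ?w m * ?P (e i) (e m)) - (\<Sum>j\<in>J. \<Sum>m\<in>I. ?v j * ?w m * ?P (f j) (e m))
    = - (\<Sum>m\<in>I. \<Sum>i\<in>I. \<Sum>j\<in>J. ?w m * ?w i * ?v j * D (f j) (e i)
         * (h X (bracket N (f j) (e m)) * h (bracket N (e i) (e m)) Y))"
  proof -
    have "(\<Sum>i\<in>I. ?w i * ?P (e i) (e m)) - (\<Sum>j\<in>J. ?v j * ?P (f j) (e m))
      = (\<Sum>i\<in>I. \<Sum>j\<in>J. ?w i * ?v j * (k (f j) (e i) - h (f j) (e i)) * (h X (bracket N (f j) (e m)) * h (bracket N (e i) (e m)) Y))" for m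
      using frame_trace_diff [OF h k sesq_bracket_left [OF sh X Y, of "e m"]] by simp
    also have "\<dots> m = - (\<Sum>i\<in>I. \<Sum>j\<in>J. ?w i * ?v j * D (f j) (e i) * (h X (bracket N (f j) (e m)) * h (bracket N (e i) (e m)) Y))" for m
      unfolding D_def sum_negf [symmetric] by (intro sum.cong) (auto simp: algebra_simps)
    finally have "?w m * ((\<Sum>i\<in>I. ?w i * ?P (e i) (e m)) - (\<Sum>j\<in>J. ?v j * ?P (f j) (e m)))
      = - (\<Sum>i\<in>I. \<Sum>j\<in>J. ?w m * ?w i * ?v j * D (f j) (e i) * (h X (bracket N (f j) (e m)) * h (bracket N (e i) (e m)) Y))" for m
      by (simp add: sum_distrib_left mult_ac)
    then have "(\<Sum>m\<in>I. ?w m * ((\<Sum>i\<in>I. ?w i * ?P (e i) (e m)) - (\<Sum>j\<in>J. ?v j * ?P (f j) (e m))))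
       = - (\<Sum>m\<in>I. \<Sum>i\<in>I. \<Sum>j\<in>J. ?w m * ?w i * ?v j * D (f j) (e i) * (h X (bracket N (f j) (e m)) * h (bracket N (e i) (e m)) Y))"
      by (simp add: sum_negf)
    moreover have "(\<Sum>i\<in>I. \<Sum>m\<in>I. ?w i * ?w m * ?P (e i) (e m)) = (\<Sum>m\<in>I. ?w m * (\<Sum>i\<in>I. ?w i * ?P (e i) (e m)))"
      by (subst sum.swap) (simp add: sum_distrib_left mult_ac)
    moreover have "(\<Sum>j\<in>J. \<Sum>m\<in>I. ?v j * ?w m * ?P (f j) (e m)) = (\<Sum>m\<in>I. ?w m * (\<Sum>j\<in>J. ?v j * ?P (f j) (e m)))"
      by (subst sum.swap) (simp add: sum_distrib_left mult_ac)
    ultimately show ?thesis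
      by (simp add: right_diff_distrib sum_subtractf)
  qed
  \<comment> \<open>Now the second index, with the first already in \<open>f\<close>.\<close>
  have 2: "(\<Sum>m\<in>J. \<Sum>i\<in>I. ?v m * ?w i * ?P (f m) (e i)) - (\<Sum>m\<in>J. \<Sum>j\<in>J. ?v m * ?v j * ?P (f m) (f j))
    = - (\<Sum>m\<in>J. \<Sum>i\<in>I. \<Sum>j\<in>J. ?v m * ?w i * ?v j * D (f j) (e i)
         * (h X (bracket N (f m) (f j)) * h (bracket N (f m) (e i)) Y))"
  proof -
    have "(\<Sum>i\<in>I. ?w i * ?P (f m) (e i)) - (\<Sum>j\<in>J. ?v j * ?P (f m) (f j))
      = (\<Sum>i\<in>I. \<Sum>j\<in>J. ?w i * ?v j * (k (f j) (e i) - h (f j) (e i)) * (h X (bracket N (f m) (f j)) * h (bracket N (f m) (e i)) Y))" for m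
      using frame_trace_diff [OF h k sesq_bracket_right [OF sh X Y, of "f m"]] by simp
    also have "\<dots> m = - (\<Sum>i\<in>I. \<Sum>j\<in>J. ?w i * ?v j * D (f j) (e i) * (h X (bracket N (f m) (f j)) * h (bracket N (f m) (e i)) Y))" for m
      unfolding D_def sum_negf [symmetric] by (intro sum.cong) (auto simp: algebra_simps)
    finally have "?v m * ((\<Sum>i\<in>I. ?w i * ?P (f m) (e i)) - (\<Sum>j\<in>J. ?v j * ?P (f m) (f j)))
      = - (\<Sum>i\<in>I. \<Sum>j\<in>J. ?v m * ?w i * ?v j * D (f j) (e i) * (h X (bracket N (f m) (f j)) * h (bracket N (f m) (e i)) Y))" for m
      by (simp add: sum_distrib_left mult_ac)
    then have "(\<Sum>m\<in>J. ?v m * ((\<Sum>i\<in>I. ?w i * ?P (f m) (e i)) - (\<Sum>j\<in>J. ?v j * ?P (f m) (f j))))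
       = - (\<Sum>m\<in>J. \<Sum>i\<in>I. \<Sum>j\<in>J. ?v m * ?w i * ?v j * D (f j) (e i) * (h X (bracket N (f m) (f j)) * h (bracket N (f m) (e i)) Y))"
      by (simp add: sum_negf)
    then show ?thesis
      by (simp add: right_diff_distrib sum_subtractf sum_distrib_left mult_ac)
  qed
  \<comment> \<open>The frames agree by now; the product of two values of \<open>h\<close> is turned
    into one of \<open>k\<close>, a factor at a time.\<close>
  have 3: "(\<Sum>i\<in>J. \<Sum>j\<in>J. ?v i * ?v j * ?P (f i) (f j))
     - (\<Sum>i\<in>J. \<Sum>j\<in>J. ?v i * ?v j * (k X (bracket N (f i) (f j)) * k (bracket N (f i) (f j)) Y))
     = (\<Sum>i\<in>J. \<Sum>j\<in>J. ?v i * ?v j * (D X (bracket N (f i) (f j)) * h (bracket N (f i) (f j)) Y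
         + k X (bracket N (f i) (f j)) * D (bracket N (f i) (f j)) Y))"
    unfolding D_def sum_subtractf [symmetric] by (intro sum.cong) (auto simp: algebra_simps)
  have telescope: "a - d = - p - q + r" if "a - b = - p" "b - c = - q" "c - d = r" for a b c d p q r :: complex
  proof -
    have "a - d = (a - b) + (b - c) + (c - d)" by simp
    with that show ?thesis by simp
  qed
  show ?thesis
    unfolding curv_def using telescope [OF 1 2 3] by (simp only: right_diff_distrib times_divide_eq_right) simp
qed

text \<open>Every term of \<open>curv_diff\<close> carries a factor \<open>D\<close>, which is zero
  here. This yields independence of the unitary basis and, at the end, identifies the curvature of
  \<open>h t\<close> with \<open>kcurv t\<close>.\<close>

lemma curv_frame_cong:
  assumes h: "herm_form N h" "frame N h I w e" and k: "herm_form N k" "frame N k J v f"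
    and eq: "\<And>X Y. X \<in> sl N \<Longrightarrow> Y \<in> sl N \<Longrightarrow> h X Y = k X Y"
    and X: "X \<in> sl N" and Y: "Y \<in> sl N"
  shows "curv N h I w e X Y = curv N k J v f X Y"
proof -
  have D: "h A B - k A B = 0" if "A \<in> sl N" "B \<in> sl N" for A B
    using eq that by simp
  note e = frameD(2) [OF h(2)] and f = frameD(2) [OF k(2)]
  have "2 * (curv N h I w e X Y - curv N k J v f X Y) = 0"
    unfolding curv_diff [OF h k X Y] by (simp only: D e f X Y bracket_sl sum.neutral_const
      mult_zero_left mult_zero_right cong: sum.cong) simp
  then show ?thesis by simp
qed

section \<open>Matrix units projected to trace zero, and a norm for forms\<close>

abbreviation idx :: "nat \<Rightarrow> (nat \<times> nat) set" where
  "idx N \<equiv> {..<N} \<times> {..<N}"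

text \<open>The orthogonal projections of the matrix units to trace zero.\<close>

definition Eb :: "nat \<Rightarrow> nat \<times> nat \<Rightarrow> cmat" where
  "Eb N p = (\<lambda>i j. (if i = fst p \<and> j = snd p then 1 else 0)
     - (if fst p = snd p \<and> i = j \<and> i < N then 1 / of_nat N else 0))"

lemma Eb_sl:
  assumes "p \<in> idx N"
  shows "Eb N p \<in> sl N"
proof -
  obtain a b where p: "p = (a, b)" "a < N" "b < N" using assms by auto
  have "(\<Sum>i<N. if i = a \<and> i = b then 1 else 0) = (\<Sum>i<N. if i = a then if a = b then 1 else 0 else (0::complex))"
    by (intro sum.cong) auto
  with p show ?thesis
    by (auto simp: sl_def mat_space_def Eb_def sum_subtractf)
qed

lemma entries_le_Eb: "entries_le 2 (Eb N p)"
  unfolding entries_le_def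
proof (intro allI)
  fix i j
  have "cmod (1 / of_nat N) \<le> 1"
    by (cases "N = 0") (auto simp: norm_divide)
  then have "cmod (if fst p = snd p \<and> i = j \<and> i < N then 1 / of_nat N else 0) \<le> 1"
    by simp
  then have "cmod (Eb N p i j) \<le> 1 + 1"
    unfolding Eb_def by (intro norm_triangle_le_diff add_mono) auto
  then show "cmod (Eb N p i j) \<le> 2" by simp
qed

text \<open>The result is the traceless part of \<open>M\<close>. The trace of \<open>M\<close> is
  kept general because \<open>frame_sigma_metric\<close> applies this to a matrix that need not be
  traceless.\<close>

lemma lincomb_Eb:
  "lincomb (idx N) (\<lambda>p. M (fst p) (snd p)) (Eb N) = (\<lambda>i j. (if i < N \<and> j < N then M i j else 0)
     - (if i = j \<and> i < N then (\<Sum>a<N. M a a) / of_nat N else 0))"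
proof (intro ext)
  fix i j
  have "lincomb (idx N) (\<lambda>p. M (fst p) (snd p)) (Eb N) i j
    = (\<Sum>a<N. \<Sum>b<N. M a b * (if i = a \<and> j = b then 1 else 0)
         - M a b * (if a = b \<and> i = j \<and> i < N then 1 / of_nat N else 0))"
    by (simp add: lincomb_def Eb_def sum.cartesian_product case_prod_beta algebra_simps)
  also have "\<dots> = (\<Sum>a<N. \<Sum>b<N. M a b * (if i = a \<and> j = b then 1 else 0))
      - (\<Sum>a<N. \<Sum>b<N. M a b * (if a = b \<and> i = j \<and> i < N then 1 / of_nat N else 0))"
    by (simp add: sum_subtractf)
  also have "(\<Sum>a<N. \<Sum>b<N. M a b * (if i = a \<and> j = b then 1 else 0))
      = (\<Sum>a<N. \<Sum>b<N. if b = j then (if a = i then M i j else 0) else 0)"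
    by (intro sum.cong refl) auto
  also have "\<dots> = (if i < N \<and> j < N then M i j else 0)"
    by (cases "j < N") simp_all
  also have "(\<Sum>a<N. \<Sum>b<N. M a b * (if a = b \<and> i = j \<and> i < N then 1 / of_nat N else 0))
      = (\<Sum>a<N. \<Sum>b<N. if b = a then (if i = j \<and> i < N then M a a / of_nat N else 0) else 0)"
    by (intro sum.cong refl) auto
  also have "\<dots> = (if i = j \<and> i < N then (\<Sum>a<N. M a a) / of_nat N else 0)"
  proof -
    have if_sum: "(\<Sum>a<N. if Q then M a a / of_nat N else 0) = (if Q then (\<Sum>a<N. M a a) / of_nat N else 0)" for Q
      by (simp add: sum_divide_distrib)
    have "(\<Sum>a<N. \<Sum>b<N. if b = a then g a else 0) = (\<Sum>a<N. g a)" for g :: "nat \<Rightarrow> complex"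
      by (intro sum.cong) auto
    then show ?thesis by (simp only: if_sum)
  qed
  finally show "lincomb (idx N) (\<lambda>p. M (fst p) (snd p)) (Eb N) i j = (if i < N \<and> j < N then M i j else 0)
     - (if i = j \<and> i < N then (\<Sum>a<N. M a a) / of_nat N else 0)" .
qed

lemma sl_expand:
  assumes "X \<in> sl N"
  shows "lincomb (idx N) (\<lambda>p. X (fst p) (snd p)) (Eb N) = X"
proof -
  have "X i j = 0" if "\<not> (i < N \<and> j < N)" for i j
    using assms that unfolding sl_def mat_space_def by auto
  moreover have "(\<Sum>a<N. X a a) = 0"
    using assms by (simp add: sl_def)
  ultimately show ?thesis
    unfolding lincomb_Eb by (intro ext) simp
qed

text \<open>An l1 norm of the values on a spanning family. By \<open>sesq_bound\<close> its
  vanishing forces a sesquilinear form to vanish on \<open>sl N\<close>, although \<open>Eb\<close>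
  is linearly dependent.\<close>

definition form_norm :: "nat \<Rightarrow> (cmat \<Rightarrow> cmat \<Rightarrow> complex) \<Rightarrow> real" where
  "form_norm N S = (\<Sum>p\<in>idx N. \<Sum>q\<in>idx N. cmod (S (Eb N p) (Eb N q)))"

lemma form_norm_nonneg: "0 \<le> form_norm N S"
  by (simp add: form_norm_def sum_nonneg)

lemma sesq_bound:
  assumes S: "sesq N S" and X: "X \<in> sl N" "entries_le a X"
    and Y: "Y \<in> sl N" "entries_le b Y"
  shows "cmod (S X Y) \<le> a * b * form_norm N S"
proof -
  have fin: "finite (idx N)" by simp
  note ab = entries_le_nonneg [OF X(2)] entries_le_nonneg [OF Y(2)]
  have "S X Y = S (lincomb (idx N) (\<lambda>p. X (fst p) (snd p)) (Eb N)) Y"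
    using X by (simp add: sl_expand)
  also have "\<dots> = (\<Sum>p\<in>idx N. X (fst p) (snd p) * S (Eb N p) Y)"
    by (rule sesq_lincomb_left [OF S fin Eb_sl Y(1)])
  also have "\<dots> = (\<Sum>p\<in>idx N. X (fst p) (snd p) *
      S (Eb N p) (lincomb (idx N) (\<lambda>q. Y (fst q) (snd q)) (Eb N)))"
    using Y by (simp add: sl_expand)
  also have "\<dots> = (\<Sum>p\<in>idx N. X (fst p) (snd p) *
      (\<Sum>q\<in>idx N. cnj (Y (fst q) (snd q)) * S (Eb N p) (Eb N q)))"
    by (intro sum.cong refl arg_cong2 [where f = times] sesq_lincomb_right [OF S fin Eb_sl Eb_sl])
  also have "\<dots> = (\<Sum>p\<in>idx N. \<Sum>q\<in>idx N. X (fst p) (snd p) * cnj (Y (fst q) (snd q)) * S (Eb N p) (Eb N q))"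
    by (simp add: sum_distrib_left mult_ac)
  also have "cmod \<dots> \<le> (\<Sum>p\<in>idx N. \<Sum>q\<in>idx N. a * b * cmod (S (Eb N p) (Eb N q)))"
    by (intro sum_norm_le) (auto simp: norm_mult intro!: mult_right_mono mult_mono entries_leD X Y ab)
  also have "\<dots> = a * b * form_norm N S"
    by (simp add: form_norm_def sum_distrib_left)
  finally show ?thesis .
qed

text \<open>Cauchy-Schwarz. The Lipschitz estimate is stated in \<open>form_norm\<close>, but
  Gronwall needs a differentiable quantity, and that is the sum of squares.\<close>

lemma form_norm_square_le:
  "(form_norm M S)\<^sup>2 \<le> real (card (idx M \<times> idx M)) * (\<Sum>p\<in>idx M. \<Sum>q\<in>idx M. (cmod (S (Eb M p) (Eb M q)))\<^sup>2)"
proof -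
  have "form_norm M S = (\<Sum>(p,q)\<in>idx M \<times> idx M. cmod (S (Eb M p) (Eb M q)))"
    unfolding form_norm_def by (rule sum.cartesian_product)
  then have "(form_norm M S)\<^sup>2 \<le> (\<Sum>r\<in>idx M \<times> idx M. (case r of (p,q) \<Rightarrow> cmod (S (Eb M p) (Eb M q)))\<^sup>2) * real (card (idx M \<times> idx M))"
    by (simp only:) (rule sum_squared_le_sum_of_squares)
  also have "(\<Sum>r\<in>idx M \<times> idx M. (case r of (p,q) \<Rightarrow> cmod (S (Eb M p) (Eb M q)))\<^sup>2)
     = (\<Sum>p\<in>idx M. \<Sum>q\<in>idx M. (cmod (S (Eb M p) (Eb M q)))\<^sup>2)"
    by (subst sum.cartesian_product) (simp add: case_prod_beta)
  finally show ?thesis by (simp add: mult.commute)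
qed

subsection \<open>Unitary bases\<close>

lemma herm_inner_pos:
  assumes "herm_inner N h" "X \<in> sl N" "X \<noteq> mzero"
  shows "0 < Re (h X X)"
proof -
  have "\<forall>X\<in>sl N. X \<noteq> mzero \<longrightarrow> 0 < Re (h X X)"
    using assms(1) unfolding herm_inner_def by (elim conjE)
  with assms show ?thesis by blast
qed

text \<open>Gram-Schmidt for a family that may be dependent: a vector whose remainder
  \<open>r\<close> is zero adds no new member, so \<open>d\<close> is at most the size of the
  family.\<close>

lemma orthonormalization:
  assumes h: "herm_inner N h" and "finite I" "\<And>i. i \<in> I \<Longrightarrow> v i \<in> sl N"
  shows "\<exists>d e. d \<le> card I \<and> (\<forall>i<d. e i \<in> sl N) \<and>
     (\<forall>i<d. \<forall>j<d. h (e i) (e j) = (if i = j then 1 else 0)) \<and>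
     (\<forall>i\<in>I. \<exists>c. v i = lincomb {..<d} c e)"
  using assms(2,3)
proof (induction I rule: finite_induct)
  case empty
  then show ?case by auto
next
  case (insert k I)
  have hf: "herm_form N h" and sh: "sesq N h"
    using herm_inner_imp_herm_form [OF h] herm_form_sesq by blast+
  obtain d e where d: "d \<le> card I" and e: "\<And>i. i < d \<Longrightarrow> e i \<in> sl N"
    and orth: "\<And>i j. i < d \<Longrightarrow> j < d \<Longrightarrow> h (e i) (e j) = (if i = j then 1 else 0)"
    and span: "\<And>i. i \<in> I \<Longrightarrow> \<exists>c. v i = lincomb {..<d} c e"
    using insert.IH insert.prems by (metis insertCI)
  have vk: "v k \<in> sl N" using insert by simp
  define p where "p = lincomb {..<d} (\<lambda>i. h (v k) (e i)) e"
  define r where "r = madd (v k) (smul (-1) p)"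
  have p: "p \<in> sl N" unfolding p_def by (intro lincomb_sl) (auto simp: e)
  have r: "r \<in> sl N" unfolding r_def by (intro madd_sl smul_sl vk p)
  have vkr: "v k = madd r p"
    by (simp add: r_def madd_def smul_def fun_eq_iff)
  show ?case
  proof (cases "r = mzero")
    case True
    then have "v k = lincomb {..<d} (\<lambda>i. h (v k) (e i)) e"
      using vkr by (simp add: p_def madd_def mzero_def)
    moreover have "d \<le> card (insert k I)" using d insert.hyps by simp
    ultimately show ?thesis using e orth span by blast
  next
    case False
    have hr: "h r (e j) = 0" if j: "j < d" for j
    proof -
      have "h p (e j) = (\<Sum>i<d. h (v k) (e i) * h (e i) (e j))"
        unfolding p_def using e j by (intro sesq_lincomb_left [OF sh]) auto
      also have "\<dots> = (\<Sum>i<d. if i = j then h (v k) (e j) else 0)"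
        using orth j by (intro sum.cong) auto
      finally have "h p (e j) = h (v k) (e j)" using j by simp
      then show ?thesis
        using j by (simp add: r_def sesq_madd_left [OF sh] sesq_smul_left [OF sh] vk p e smul_sl)
    qed
    have hr': "h (e j) r = 0" if j: "j < d" for j
      using hr [OF j] herm_form_cnj [OF hf r e [OF j]] by simp
    define s where "s = Re (h r r)"
    have s: "0 < s" "h r r = of_real s"
      using herm_inner_pos [OF h r False] herm_form_self_real [OF hf r] by (auto simp: s_def)
    define u where "u = smul (of_real (1 / sqrt s)) r"
    have u: "u \<in> sl N" by (simp add: u_def smul_sl r)
    have uu: "h u u = 1"
    proof -
      have "h u u = of_real (1 / sqrt s) * (of_real (1 / sqrt s) * of_real s)"
        by (simp add: u_def sesq_smul_left [OF sh] sesq_smul_right [OF sh] r smul_sl s)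
      also have "\<dots> = of_real (1 / sqrt s * (1 / sqrt s * s))"
        by (simp only: of_real_mult)
      also have "1 / sqrt s * (1 / sqrt s * s) = 1"
        using s by (simp add: field_simps)
      finally show ?thesis by simp
    qed
    have ue: "h u (e j) = 0" "h (e j) u = 0" if "j < d" for j
      using that by (simp_all add: u_def sesq_smul_left [OF sh] sesq_smul_right [OF sh] r e hr hr')
    define e' where "e' = e(d := u)"
    have lift: "\<exists>c'. madd (smul a u) (lincomb {..<d} c e) = lincomb {..<Suc d} c' e'" for a c
      by (intro exI [of _ "c(d := a)"]) (simp add: lincomb_def madd_def smul_def e'_def fun_eq_iff)
    have "\<forall>i<Suc d. e' i \<in> sl N"
      using e u by (auto simp: e'_def less_Suc_eq)
    moreover have "\<forall>i<Suc d. \<forall>j<Suc d. h (e' i) (e' j) = (if i = j then 1 else 0)"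
      using orth uu ue by (auto simp: e'_def less_Suc_eq)
    moreover have "\<exists>c. v i = lincomb {..<Suc d} c e'" if i: "i \<in> insert k I" for i
    proof (cases "i = k")
      case True
      have "smul (of_real (sqrt s)) u = r"
        using s by (simp add: u_def smul_def fun_eq_iff)
      then have "v i = madd (smul (of_real (sqrt s)) u) p" using vkr True by simp
      then show ?thesis
        using lift [of "of_real (sqrt s)" "\<lambda>i. h (v k) (e i)"] by (simp only: p_def)
    next
      case False
      then obtain c where "v i = lincomb {..<d} c e" using i span by blast
      then show ?thesis using lift [of 0 c] by (simp add: madd_def smul_def)
    qed
    moreover have "Suc d \<le> card (insert k I)" using d insert.hyps by simp
    ultimately show ?thesis by blast
  qed
qed

text \<open>The bound on \<open>d\<close> is crude but the same for all metrics, as estimates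
  uniform in time require. It is also the size of the frame \<open>Eb\<close>.\<close>

lemma unitary_basis_exists:
  assumes "herm_inner N h"
  shows "\<exists>d e. d \<le> N * N \<and> unitary_basis N h d e"
proof -
  obtain d e where d: "d \<le> card (idx N)" and e: "\<forall>i<d. e i \<in> sl N"
    "\<forall>i<d. \<forall>j<d. h (e i) (e j) = (if i = j then 1 else 0)"
    and span: "\<And>p. p \<in> idx N \<Longrightarrow> \<exists>c. Eb N p = lincomb {..<d} c e"
    using orthonormalization [OF assms, of "idx N" "Eb N"] Eb_sl by auto
  obtain c where c: "\<And>p. p \<in> idx N \<Longrightarrow> Eb N p = lincomb {..<d} (c p) e"
    using span by metis
  have "\<exists>c. X = (\<lambda>a b. \<Sum>i<d. c i * e i a b)" if X: "X \<in> sl N" for X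
  proof (intro exI ext)
    fix a b
    have "X a b = (\<Sum>p\<in>idx N. X (fst p) (snd p) * Eb N p a b)"
      using sl_expand [OF X] by (metis lincomb_def)
    also have "\<dots> = (\<Sum>p\<in>idx N. X (fst p) (snd p) * (\<Sum>i<d. c p i * e i a b))"
      by (intro sum.cong) (auto simp: c lincomb_def)
    also have "\<dots> = (\<Sum>p\<in>idx N. \<Sum>i<d. X (fst p) (snd p) * c p i * e i a b)"
      by (simp add: sum_distrib_left mult_ac)
    also have "\<dots> = (\<Sum>i<d. (\<Sum>p\<in>idx N. X (fst p) (snd p) * c p i) * e i a b)"
      by (subst sum.swap) (simp add: sum_distrib_right)
    finally show "X a b = (\<Sum>i<d. (\<Sum>p\<in>idx N. X (fst p) (snd p) * c p i) * e i a b)" .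
  qed
  then have "unitary_basis N h d e"
    unfolding unitary_basis_def using e by blast
  with d show ?thesis by auto
qed

text \<open>By Parseval the coefficients of \<open>X\<close> in a unitary basis are at most the
  \<open>h\<close>-length of \<open>X\<close>, so \<open>C\<close> only has to sum the entries of
  one fixed basis. Applied to the metric at a final time, this controls the unitary bases of all
  earlier ones.\<close>

lemma herm_inner_entry_bound:
  assumes h: "herm_inner N h"
  shows "\<exists>C\<ge>0. \<forall>X\<in>sl N. entries_le (C * sqrt (Re (h X X))) X"
proof -
  obtain d e where u: "unitary_basis N h d e"
    using unitary_basis_exists [OF h] by blast
  have hf: "herm_form N h" and sh: "sesq N h"
    using herm_inner_imp_herm_form [OF h] herm_form_sesq by blast+
  note fr = frameD [OF unitary_basis_imp_frame [OF hf u]]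
  define C where "C = (\<Sum>a<N. \<Sum>b<N. \<Sum>i<d. cmod (e i a b))"
  have C0: "0 \<le> C" by (simp add: C_def sum_nonneg)
  moreover have "cmod (X a b) \<le> C * sqrt (Re (h X X))" if X: "X \<in> sl N" for X a b
  proof (cases "a < N \<and> b < N")
    case ab: True
    have "h X X = h (lincomb {..<d} (\<lambda>i. of_real 1 * h X (e i)) e) X"
      using fr(3) [OF X] by simp
    also have "\<dots> = (\<Sum>i<d. of_real 1 * h X (e i) * h (e i) X)"
      by (rule sesq_lincomb_left [OF sh fr(1,2) X])
    also have "\<dots> = (\<Sum>i<d. of_real ((cmod (h X (e i)))\<^sup>2))"
    proof (intro sum.cong refl)
      fix i assume "i \<in> {..<d}"
      then have "h (e i) X = cnj (h X (e i))"
        using herm_form_cnj [OF hf X fr(2)] by simp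
      then show "of_real 1 * h X (e i) * h (e i) X = of_real ((cmod (h X (e i)))\<^sup>2)"
        by (simp add: complex_norm_square [symmetric] flip: of_real_power)
    qed
    finally have hXX: "Re (h X X) = (\<Sum>i<d. (cmod (h X (e i)))\<^sup>2)" by simp
    have le: "cmod (h X (e i)) \<le> sqrt (Re (h X X))" if "i < d" for i
      unfolding hXX using that by (intro real_le_rsqrt member_le_sum) auto
    have "X a b = (\<Sum>i<d. h X (e i) * e i a b)"
      using fr(3) [OF X] by (metis (no_types, lifting) lincomb_def mult_1 of_real_1 sum.cong)
    also have "cmod \<dots> \<le> (\<Sum>i<d. sqrt (Re (h X X)) * cmod (e i a b))"
      by (intro sum_norm_le) (auto simp: norm_mult intro!: mult_right_mono le)
    also have "\<dots> = (\<Sum>i<d. cmod (e i a b)) * sqrt (Re (h X X))"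
      by (simp add: sum_distrib_left [symmetric])
    also have "(\<Sum>i<d. cmod (e i a b)) \<le> (\<Sum>b<N. \<Sum>i<d. cmod (e i a b))"
      using ab by (intro member_le_sum [of b "{..<N}" "\<lambda>b. \<Sum>i<d. cmod (e i a b)"]) (auto intro!: sum_nonneg)
    also have "\<dots> \<le> C"
      unfolding C_def using ab
      by (intro member_le_sum [of a "{..<N}" "\<lambda>a. \<Sum>b<N. \<Sum>i<d. cmod (e i a b)"]) (auto intro!: sum_nonneg)
    finally show ?thesis
      using hXX by (simp add: mult_right_mono sum_nonneg)
  next
    case False
    then have "X a b = 0" using X by (auto simp: sl_def mat_space_def)
    moreover have "0 \<le> Re (h X X)"
    proof (cases "X = mzero")
      case True
      then show ?thesis using sesq_mzero_left [OF sh X] by simp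
    next
      case False
      then show ?thesis using herm_inner_pos [OF h X] by simp
    qed
    ultimately show ?thesis using C0 by simp
  qed
  ultimately show ?thesis unfolding entries_le_def by blast
qed

section \<open>Existence and uniqueness of the endomorphism behind \<open>Theta\<close>\<close>

lemma sum_lt_pairs:
  fixes G :: "nat \<Rightarrow> nat \<Rightarrow> complex"
  assumes "\<And>i j. G i j = G j i" "\<And>i. G i i = 0"
  shows "(\<Sum>(i,j)\<in>{(i,j). i < j \<and> j < d}. G i j) = (\<Sum>i<d. \<Sum>j<d. G i j) / 2"
proof (induction d)
  case 0
  then show ?case by simp
next
  case (Suc d)
  have fin: "finite {(i,j). i < j \<and> j < d}"
    by (rule finite_subset [of _ "{..<d} \<times> {..<d}"]) auto
  have "{(i,j). i < j \<and> j < Suc d} = {(i,j). i < j \<and> j < d} \<union> (\<lambda>i. (i, d)) ` {..<d}"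
    by (auto simp: less_Suc_eq)
  then have "(\<Sum>(i,j)\<in>{(i,j). i < j \<and> j < Suc d}. G i j)
     = (\<Sum>(i,j)\<in>{(i,j). i < j \<and> j < d}. G i j) + (\<Sum>(i,j)\<in>(\<lambda>i. (i, d)) ` {..<d}. G i j)"
    by (simp only:) (rule sum.union_disjoint, use fin in auto)
  also have "(\<Sum>(i,j)\<in>(\<lambda>i. (i, d)) ` {..<d}. G i j) = (\<Sum>i<d. G i d)"
    by (subst sum.reindex) (auto simp: inj_on_def)
  finally show ?case
    unfolding Suc.IH using assms by (simp add: sum.distrib field_simps)
qed

lemma curv_unitary:
  fixes d :: nat
  assumes "sesq N h" "X \<in> sl N" "Y \<in> sl N"
  shows "curv N h {..<d} (\<lambda>_. 1) e X Y = (\<Sum>(i,j)\<in>{(i,j). i < j \<and> j < d}.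
     h X (bracket N (e i) (e j)) * h (bracket N (e i) (e j)) Y)"
proof -
  let ?G = "\<lambda>i j. h X (bracket N (e i) (e j)) * h (bracket N (e i) (e j)) Y"
  have "?G i j = ?G j i" for i j
    by (subst (1 2) bracket_swap [of N "e i" "e j"])
      (simp add: sesq_smul_left [OF assms(1)] sesq_smul_right [OF assms(1)] bracket_sl assms)
  moreover have "?G i i = 0" for i
    by (simp add: bracket_self sesq_mzero_right [OF assms(1,2)])
  ultimately show ?thesis
    unfolding curv_def using sum_lt_pairs [of ?G d] by simp
qed

lemma curv_unitary_self:
  fixes d :: nat
  assumes h: "herm_form N h" and X: "X \<in> sl N"
  shows "curv N h {..<d} (\<lambda>_. 1) e X X = of_real (\<Sum>(i,j)\<in>{(i,j). i < j \<and> j < d}.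
     (cmod (h (bracket N (e i) (e j)) X))\<^sup>2)"
proof -
  have "h X (bracket N A B) * h (bracket N A B) X = of_real ((cmod (h (bracket N A B) X))\<^sup>2)" for A B
    using herm_form_cnj [OF h bracket_sl [of N A B] X]
    by (metis complex_norm_square mult.commute)
  then show ?thesis
    using curv_unitary [OF herm_form_sesq [OF h] X X, of d e] by (simp add: case_prod_beta)
qed

text \<open>The candidate sends \<open>X\<close> to the sum of \<open>h X b\<close> times
  \<open>b\<close> over the brackets \<open>b\<close> of one chosen basis. The clause of
  \<open>is_P\<close> that ranges over all unitary bases holds because \<open>curv\<close> is the
  same in every frame of \<open>h\<close>.\<close>

lemma is_P_exists:
  assumes h: "herm_inner N h" and u: "unitary_basis N h d e"
  shows "\<exists>P. is_P N h P \<and> (\<forall>X\<in>sl N. \<forall>Y\<in>sl N. h (P X) Y = curv N h {..<d} (\<lambda>_. 1) e X Y)"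
proof -
  have hf: "herm_form N h" and sh: "sesq N h"
    using herm_inner_imp_herm_form [OF h] herm_form_sesq by blast+
  define I where "I = {(i,j). i < j \<and> j < d}"
  define b where "b = (\<lambda>(i,j). bracket N (e i) (e j))"
  have fin: "finite I"
    unfolding I_def by (rule finite_subset [of _ "{..<d} \<times> {..<d}"]) auto
  have b: "b p \<in> sl N" for p by (simp add: b_def case_prod_beta bracket_sl)
  define P where "P X = (if X \<in> sl N then lincomb I (\<lambda>p. h X (b p)) b else mzero)" for X
  have PX: "P X \<in> sl N" for X
    by (simp add: P_def mzero_sl lincomb_sl fin b)
  have left: "h (P X) Y = (\<Sum>p\<in>I. h X (b p) * h (b p) Y)" if "X \<in> sl N" "Y \<in> sl N" for X Y
    using that by (simp add: P_def sesq_lincomb_left [OF sh fin b])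
  have right: "h X (P Y) = (\<Sum>p\<in>I. h X (b p) * h (b p) Y)" if "X \<in> sl N" "Y \<in> sl N" for X Y
    using that by (simp add: P_def sesq_lincomb_right [OF sh fin b] herm_form_cnj [OF hf] b mult.commute)
  have curv: "h (P X) Y = curv N h {..<d} (\<lambda>_. 1) e X Y" if "X \<in> sl N" "Y \<in> sl N" for X Y
    using that by (simp add: left curv_unitary [OF sh] I_def b_def case_prod_beta)
  have "P X = mzero" if "X \<notin> sl N" for X
    using that by (simp add: P_def)
  moreover have "P (madd X Y) = madd (P X) (P Y)" if "X \<in> sl N" "Y \<in> sl N" for X Y
    using that by (simp add: P_def madd_sl sesq_madd_left [OF sh] b lincomb_def)
      (simp add: madd_def sum.distrib algebra_simps)
  moreover have "P (smul c X) = smul c (P X)" if "X \<in> sl N" for c X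
    using that by (simp add: P_def smul_sl sesq_smul_left [OF sh] b lincomb_def)
      (simp add: smul_def sum_distrib_left algebra_simps)
  moreover have "h (P X) X = of_real (\<Sum>(i,j)\<in>{(i,j). i < j \<and> j < d'}. (cmod (h (bracket N (f i) (f j)) X))\<^sup>2)"
    if "unitary_basis N h d' f" "X \<in> sl N" for d' f X
  proof -
    have "h (P X) X = curv N h {..<d'} (\<lambda>_. 1) f X X"
      unfolding curv [OF that(2,2)]
      by (intro curv_frame_cong [OF hf _ hf] unitary_basis_imp_frame hf u that refl)
    then show ?thesis by (simp add: curv_unitary_self [OF hf that(2)])
  qed
  ultimately have "is_P N h P"
    unfolding is_P_def
    by (intro conjI allI ballI impI) (simp_all only: left right PX)
  with curv show ?thesis by blast
qed

text \<open>Only the quadratic form of the endomorphism is prescribed. Over the complex numbers a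
  sesquilinear form that vanishes on the diagonal vanishes by polarization, and \<open>h\<close> is
  definite.\<close>

lemma is_P_unique:
  assumes h: "herm_inner N h" and P: "is_P N h P" and Q: "is_P N h Q"
  shows "P = Q"
proof
  fix X
  obtain d e where u: "unitary_basis N h d e"
    using unitary_basis_exists [OF h] by blast
  have hf: "herm_form N h" and sh: "sesq N h"
    using herm_inner_imp_herm_form [OF h] herm_form_sesq by blast+
  have R_sl: "R X \<in> sl N" if "is_P N h R" "X \<in> sl N" for R X
    using that unfolding is_P_def by (elim conjE) blast
  note PQ_sl = R_sl [OF P] R_sl [OF Q]
  define G where "G X Y = h (P X) Y - h (Q X) Y" for X Y
  have "sesq N (\<lambda>X. h (R X))" if R: "is_P N h R" for R
  proof -
    have "R (madd X Y) = madd (R X) (R Y)" if "X \<in> sl N" "Y \<in> sl N" for X Y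
      using R that unfolding is_P_def by blast
    moreover have "R (smul c X) = smul c (R X)" if "X \<in> sl N" for X c
      using R that unfolding is_P_def by blast
    ultimately show ?thesis using sh R_sl [OF R] by (simp add: sesq_def)
  qed
  then have G: "sesq N G"
    unfolding G_def using sesq_diff P Q by blast
  have G0: "G X X = 0" if "X \<in> sl N" for X
  proof -
    have "h (P X) X = h (Q X) X"
    proof -
      have "h (R X) X = of_real (\<Sum>(i,j)\<in>{(i,j). i < j \<and> j < d}. (cmod (h (bracket N (e i) (e j)) X))\<^sup>2)"
        if "is_P N h R" for R
        using that u \<open>X \<in> sl N\<close> unfolding is_P_def by (elim conjE) simp
      with P Q show ?thesis by simp
    qed
    then show ?thesis by (simp add: G_def)
  qed
  show "P X = Q X"
  proof (cases "X \<in> sl N")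
    case X: True
    have "G X Y = 0" if Y: "Y \<in> sl N" for Y
    proof -
      have 1: "G X Z + G Z X = 0" if Z: "Z \<in> sl N" for Z
        using G0 [OF madd_sl [OF X Z]] G0 [OF X] G0 [OF Z]
        by (simp add: sesq_madd_left [OF G] sesq_madd_right [OF G] X Z madd_sl add.commute)
      \<comment> \<open>Substituting \<open>\<i>\<close> times \<open>Y\<close> for \<open>Z\<close>
        gives symmetry in \<open>X\<close> and \<open>Y\<close>, where \<open>Y\<close> itself gives
        antisymmetry. Together they force the value zero.\<close>
      have "- \<i> * G X Y + \<i> * G Y X = 0"
        using 1 [OF smul_sl [OF Y, of \<i>]] by (simp add: sesq_smul_left [OF G] sesq_smul_right [OF G] X Y)
      then have "\<i> * (G Y X - G X Y) = 0" by (simp add: algebra_simps)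
      then have "G Y X = G X Y" by simp
      with 1 [OF Y] show ?thesis by simp
    qed
    \<comment> \<open>The difference of the two images, about to be paired with itself.\<close>
    moreover define Z where "Z = madd (P X) (smul (-1) (Q X))"
    ultimately have "h (P X) Z = h (Q X) Z"
      using PQ_sl [OF X] by (simp add: G_def madd_sl smul_sl)
    then have "h Z Z = 0"
      using PQ_sl [OF X] by (subst Z_def) (simp add: sesq_madd_left [OF sh] sesq_smul_left [OF sh] madd_sl smul_sl Z_def)
    moreover have "Z \<in> sl N" using PQ_sl [OF X] by (simp add: Z_def madd_sl smul_sl)
    ultimately have "Z = mzero"
      using herm_inner_pos [OF h] by force
    then show ?thesis
      by (simp add: Z_def madd_def smul_def mzero_def fun_eq_iff)
  next
    case False
    then have "R X = mzero" if "is_P N h R" for R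
      using that unfolding is_P_def by (elim conjE) simp
    with P Q show ?thesis by simp
  qed
qed

lemma Theta_eq_curv:
  assumes h: "herm_inner N h" and u: "unitary_basis N h d e" and X: "X \<in> sl N" and Y: "Y \<in> sl N"
  shows "Theta N h X Y = curv N h {..<d} (\<lambda>_. 1) e X Y"
proof -
  obtain P where P: "is_P N h P" "h (P X) Y = curv N h {..<d} (\<lambda>_. 1) e X Y"
    using is_P_exists [OF h u] X Y by blast
  have "(THE P. is_P N h P) = P"
    using P(1) is_P_unique [OF h _ P(1)] by (intro the_equality)
  with P(2) show ?thesis by (simp add: Theta_def)
qed

text \<open>A sum of squares in any unitary basis. Along the flow it makes \<open>h t X X\<close>
  nonincreasing in \<open>t\<close>.\<close>

lemma Theta_self_nonneg:
  assumes h: "herm_inner N h" and X: "X \<in> sl N"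
  shows "0 \<le> Re (Theta N h X X)"
proof -
  obtain d e where u: "unitary_basis N h d e"
    using unitary_basis_exists [OF h] by blast
  show ?thesis
    unfolding Theta_eq_curv [OF h u X X] curv_unitary_self [OF herm_inner_imp_herm_form [OF h] X]
    by (auto intro: sum_nonneg)
qed

section \<open>Lipschitz dependence of the curvature on the metric\<close>

lemma norm_sum_card_le:
  fixes g :: "'i \<Rightarrow> complex"
  assumes "\<And>i. i \<in> K \<Longrightarrow> cmod (g i) \<le> c" "card K \<le> M" "0 \<le> c"
  shows "cmod (sum g K) \<le> real M * c"
proof -
  have "cmod (sum g K) \<le> (\<Sum>i\<in>K. c)" by (intro sum_norm_le assms)
  also have "\<dots> \<le> real M * c" using assms by (simp add: mult_right_mono)
  finally show ?thesis .
qed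

text \<open>The constant sees metrics and frames only through the bounds \<open>C\<close>,
  \<open>V\<close>, \<open>M\<close>, \<open>H\<close>, so one constant can serve a whole time
  interval. \<open>B\<close> is the product of the bound \<open>C\<close> for a vector and the bound
  of \<open>entries_le_bracket\<close> for the bracket it is paired with. The cubic term comes from
  exchanging frames, the quadratic one from exchanging the form.\<close>

lemma curv_lipschitz:
  assumes h: "herm_form N h" "frame N h I w e" and k: "herm_form N k" "frame N k J v f"
    and X: "X \<in> sl N" "entries_le C X" and Y: "Y \<in> sl N" "entries_le C Y"
    and e: "\<And>m. m \<in> I \<Longrightarrow> entries_le C (e m)" and f: "\<And>m. m \<in> J \<Longrightarrow> entries_le C (f m)"
    and w: "\<And>m. m \<in> I \<Longrightarrow> \<bar>w m\<bar> \<le> V" and v: "\<And>m. m \<in> J \<Longrightarrow> \<bar>v m\<bar> \<le> V"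
    and card: "card I \<le> M" "card J \<le> M"
    and H: "form_norm N h \<le> H" "form_norm N k \<le> H" and "1 \<le> C" "1 \<le> V"
  defines "B \<equiv> C * (2 * real N * C * C)"
  shows "cmod (curv N h I w e X Y - curv N k J v f X Y)
    \<le> (real M ^ 3 * V ^ 3 * C\<^sup>2 * (B * H)\<^sup>2 + real M ^ 2 * V ^ 2 * B\<^sup>2 * H) * form_norm N (\<lambda>X Y. h X Y - k X Y)"
proof -
  define D where "D = (\<lambda>X Y. h X Y - k X Y)"
  define \<delta> where "\<delta> = form_norm N D"
  have sh: "sesq N h" and sk: "sesq N k" using h k herm_form_sesq by blast+
  have sD: "sesq N D" unfolding D_def by (intro sesq_diff sh sk)
  have pos: "0 \<le> \<delta>" "0 \<le> H" "0 \<le> C" "0 \<le> V" "0 \<le> B"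
    using \<open>1 \<le> C\<close> \<open>1 \<le> V\<close> order_trans [OF form_norm_nonneg H(1)]
    by (auto simp: \<delta>_def form_norm_nonneg B_def)
  note esl = frameD(2) [OF h(2)] and fsl = frameD(2) [OF k(2)]
  have Sl: "cmod (S Z (bracket N A A')) \<le> B * form_norm N S"
    if "sesq N S" "Z \<in> sl N" "entries_le C Z" "entries_le C A" "entries_le C A'" for S Z A A'
    using sesq_bound [OF that(1-3) bracket_sl entries_le_bracket [OF that(4,5)]] by (simp add: B_def)
  have Sr: "cmod (S (bracket N A A') Z) \<le> B * form_norm N S"
    if "sesq N S" "Z \<in> sl N" "entries_le C Z" "entries_le C A" "entries_le C A'" for S Z A A'
    using sesq_bound [OF that(1) bracket_sl entries_le_bracket [OF that(4,5)] that(2,3)] by (simp add: B_def mult_ac)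
  have BH: "B * form_norm N h \<le> B * H" "B * form_norm N k \<le> B * H"
    using H pos by (auto intro: mult_left_mono)
  have hX: "cmod (h X (bracket N A A')) \<le> B * H" and hY: "cmod (h (bracket N A A') Y) \<le> B * H"
    and kX: "cmod (k X (bracket N A A')) \<le> B * H"
    and DX: "cmod (D X (bracket N A A')) \<le> B * \<delta>" and DY: "cmod (D (bracket N A A') Y) \<le> B * \<delta>"
    if "entries_le C A" "entries_le C A'" for A A'
    using Sl [OF sh X that] Sr [OF sh Y that] Sl [OF sk X that] Sl [OF sD X that] Sr [OF sD Y that] BH
    by (auto simp: \<delta>_def)
  have Dfe: "cmod (D (f j) (e i)) \<le> C\<^sup>2 * \<delta>" if "i \<in> I" "j \<in> J" for i j
    using sesq_bound [OF sD fsl [OF that(2)] f [OF that(2)] esl [OF that(1)] e [OF that(1)]]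
    by (simp add: \<delta>_def power2_eq_square)
  have term3: "cmod (of_real a * of_real b * of_real c * d * (p * q)) \<le> V ^ 3 * (C\<^sup>2 * \<delta>) * (B * H)\<^sup>2"
    if "\<bar>a\<bar> \<le> V" "\<bar>b\<bar> \<le> V" "\<bar>c\<bar> \<le> V" "cmod d \<le> C\<^sup>2 * \<delta>" "cmod p \<le> B * H" "cmod q \<le> B * H" for a b c d p q
    unfolding norm_mult norm_of_real power2_eq_square [of "B * H"] power3_eq_cube
    using that pos by (intro mult_mono) auto
  let ?T = "V ^ 3 * (C\<^sup>2 * \<delta>) * (B * H)\<^sup>2" and ?T' = "V\<^sup>2 * (2 * (B * \<delta>) * (B * H))"
  have T: "0 \<le> ?T" "0 \<le> ?T'" using pos by simp_all
  define s1 where "s1 = (\<Sum>m\<in>I. \<Sum>i\<in>I. \<Sum>j\<in>J. of_real (w m) * of_real (w i) * of_real (v j) * D (f j) (e i)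
         * (h X (bracket N (f j) (e m)) * h (bracket N (e i) (e m)) Y))"
  define s2 where "s2 = (\<Sum>m\<in>J. \<Sum>i\<in>I. \<Sum>j\<in>J. of_real (v m) * of_real (w i) * of_real (v j) * D (f j) (e i)
         * (h X (bracket N (f m) (f j)) * h (bracket N (f m) (e i)) Y))"
  define s3 where "s3 = (\<Sum>i\<in>J. \<Sum>j\<in>J. of_real (v i) * of_real (v j) * (D X (bracket N (f i) (f j)) * h (bracket N (f i) (f j)) Y
         + k X (bracket N (f i) (f j)) * D (bracket N (f i) (f j)) Y))"
  have 1: "cmod s1 \<le> real M * (real M * (real M * ?T))"
    unfolding s1_def using T pos
    by (intro norm_sum_card_le term3 w v Dfe hX hY e f card) auto
  have 2: "cmod s2 \<le> real M * (real M * (real M * ?T))"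
    unfolding s2_def using T pos
    by (intro norm_sum_card_le term3 w v Dfe hX hY e f card) auto
  have term2: "cmod (of_real a * of_real b * (p * q + p' * q')) \<le> ?T'"
    if "\<bar>a\<bar> \<le> V" "\<bar>b\<bar> \<le> V" "cmod p \<le> B * \<delta>" "cmod q \<le> B * H" "cmod p' \<le> B * H" "cmod q' \<le> B * \<delta>" for a b p q p' q'
  proof -
    have "cmod (p * q) \<le> (B * \<delta>) * (B * H)" "cmod (p' * q') \<le> (B * H) * (B * \<delta>)"
      unfolding norm_mult using that pos by (intro mult_mono; simp)+
    then have "cmod (p * q + p' * q') \<le> 2 * (B * \<delta>) * (B * H)"
      using norm_triangle_ineq [of "p * q" "p' * q'"] by (simp add: mult_ac)
    then show ?thesis
      unfolding norm_mult norm_of_real power2_eq_square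
      using that pos by (intro mult_mono) auto
  qed
  have 3: "cmod s3 \<le> real M * (real M * ?T')"
    unfolding s3_def using T pos
    by (intro norm_sum_card_le term2 w v DX DY hY kX f card) auto
  have "2 * (curv N h I w e X Y - curv N k J v f X Y) = - s1 - s2 + s3"
    using curv_diff [OF h k X(1) Y(1)] unfolding s1_def s2_def s3_def D_def .
  then have "2 * cmod (curv N h I w e X Y - curv N k J v f X Y) = cmod (- s1 - s2 + s3)"
    by (metis norm_mult norm_numeral)
  also have "\<dots> \<le> cmod s1 + cmod s2 + cmod s3"
    using norm_triangle_ineq [of "- s1 - s2" s3] norm_triangle_ineq4 [of "- s1" s2] by simp
  finally have "2 * cmod (curv N h I w e X Y - curv N k J v f X Y)
     \<le> 2 * (real M * (real M * (real M * ?T))) + real M * (real M * ?T')"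
    using 1 2 3 by linarith
  also have "\<dots> = 2 * ((real M ^ 3 * V ^ 3 * C\<^sup>2 * (B * H)\<^sup>2 + real M ^ 2 * V ^ 2 * B\<^sup>2 * H) * \<delta>)"
    by (simp add: algebra_simps power2_eq_square power3_eq_cube)
  finally show ?thesis
    by (simp add: \<delta>_def D_def)
qed

subsection \<open>The curvature of the metrics \<open>\<sigma>\<close>\<close>

definition munit :: "nat \<times> nat \<Rightarrow> cmat" where
  "munit p = (\<lambda>i j. if i = fst p \<and> j = snd p then 1 else 0)"

definition mid :: "nat \<Rightarrow> cmat" where
  "mid N = (\<lambda>i j. if i = j \<and> i < N then 1 else 0)"

lemma Eb_munit: "Eb N p = madd (munit p) (smul (if fst p = snd p then - 1 / of_nat N else 0) (mid N))"
  by (auto simp: Eb_def munit_def mid_def madd_def smul_def fun_eq_iff)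

lemma bracket_mid: "bracket N (mid N) Y = mzero" "bracket N Y (mid N) = mzero"
proof -
  have "(\<Sum>k<N. mid N a k * Y k b) = Y a b" "(\<Sum>k<N. Y a k * mid N k b) = Y a b" if "a < N" "b < N" for a b
  proof -
    have "(\<Sum>k<N. mid N a k * Y k b) = (\<Sum>k<N. if k = a then Y a b else 0)"
      using that by (intro sum.cong) (auto simp: mid_def)
    then show "(\<Sum>k<N. mid N a k * Y k b) = Y a b" using that by simp
    have "(\<Sum>k<N. Y a k * mid N k b) = (\<Sum>k<N. if k = b then Y a b else 0)"
      using that by (intro sum.cong) (auto simp: mid_def)
    then show "(\<Sum>k<N. Y a k * mid N k b) = Y a b" using that by simp
  qed
  then show "bracket N (mid N) Y = mzero" "bracket N Y (mid N) = mzero"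
    by (auto simp: bracket_def mzero_def fun_eq_iff sum_subtractf)
qed

text \<open>\<open>Eb\<close> differs from \<open>munit\<close> by a multiple of the identity, which
  is central, so the structure constants are those of the full matrix algebra.\<close>

lemma bracket_Eb:
  assumes "a < N" "b < N" "c < N" "d < N"
  shows "bracket N (Eb N (a, b)) (Eb N (c, d)) i j
    = (if b = c then munit (a, d) i j else 0) - (if a = d then munit (c, b) i j else 0)"
proof -
  have prod: "(\<Sum>k<N. munit (a, b) i k * munit (c, d) k j) = (if b = c then munit (a, d) i j else 0)" if "b < N" for a b c d
  proof -
    have "(\<Sum>k<N. munit (a, b) i k * munit (c, d) k j)
       = (\<Sum>k<N. if k = b then (if b = c then munit (a, d) i j else 0) else 0)"
      by (intro sum.cong) (auto simp: munit_def)
    then show ?thesis using that by simp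
  qed
  have z: "madd X (smul s mzero) = X" for X s
    by (simp add: madd_def smul_def mzero_def)
  have "bracket N (Eb N (a, b)) (Eb N (c, d)) i j = bracket N (munit (a, b)) (munit (c, d)) i j"
    by (simp add: Eb_munit bracket_madd_left bracket_madd_right bracket_smul_left bracket_smul_right
        bracket_mid z)
  also have "\<dots> = (if b = c then munit (a, d) i j else 0) - (if a = d then munit (c, b) i j else 0)"
  proof (cases "i < N \<and> j < N")
    case True
    then show ?thesis
      using prod [of b a c d] prod [of d c a b] assms by (auto simp: bracket_def sum_subtractf)
  next
    case False
    then show ?thesis
      using assms by (auto simp: bracket_def munit_def)
  qed
  finally show ?thesis .
qed

lemma tr_inner_munit:
  assumes "a < N" "b < N"
  shows "(\<Sum>i<N. \<Sum>j<N. A i j * cnj (munit (a, b) i j)) = A a b"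
proof -
  have "(\<Sum>i<N. \<Sum>j<N. A i j * cnj (munit (a, b) i j)) = (\<Sum>i<N. \<Sum>j<N. if j = b then (if i = a then A a b else 0) else 0)"
    by (intro sum.cong refl) (auto simp: munit_def)
  then show ?thesis using assms by simp
qed

lemma tr_inner_bracket_Eb:
  assumes "a < N" "b < N" "c < N" "d < N"
  shows "tr_inner N A (bracket N (Eb N (a, b)) (Eb N (c, d)))
    = (if b = c then A a d else 0) - (if a = d then A c b else 0)"
proof -
  have "tr_inner N A (bracket N (Eb N (a, b)) (Eb N (c, d)))
    = (if b = c then (\<Sum>i<N. \<Sum>j<N. A i j * cnj (munit (a, d) i j)) else 0)
      - (if a = d then (\<Sum>i<N. \<Sum>j<N. A i j * cnj (munit (c, b) i j)) else 0)"
    unfolding tr_inner_def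
    by (simp add: bracket_Eb [OF assms] right_diff_distrib sum_subtractf)
  then show ?thesis using assms by (simp add: tr_inner_munit)
qed

text \<open>The trace correction in \<open>Eb\<close> is a multiple of the identity and pairs with
  \<open>A\<close> to a multiple of its trace.\<close>

lemma tr_inner_Eb:
  assumes "a < N" "b < N" "(\<Sum>i<N. A i i) = 0"
  shows "tr_inner N A (Eb N (a, b)) = A a b"
proof -
  have "(\<Sum>i<N. \<Sum>j<N. A i j * cnj (if a = b \<and> i = j \<and> i < N then 1 / of_nat N else 0))
     = (\<Sum>i<N. \<Sum>j<N. if j = i then (if a = b then A i i / of_nat N else 0) else 0)"
    by (intro sum.cong refl) auto
  also have "\<dots> = (\<Sum>i<N. if a = b then A i i / of_nat N else 0)"
    by (intro sum.cong refl) simp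
  also have "\<dots> = 0"
    using assms(3) by (cases "a = b") (simp_all add: sum_divide_distrib [symmetric])
  finally show ?thesis
    using tr_inner_munit [OF assms(1,2), of A]
    by (simp add: tr_inner_def Eb_def munit_def right_diff_distrib sum_subtractf)
qed

text \<open>On \<open>sl (Suc n)\<close>, the forms \<open>q0\<close>, \<open>q1\<close>, \<open>q2\<close> are the trace form composed with the projections to
  the upper-left block, the line spanned by \<open>Imat n\<close>, and the last row and column.\<close>

definition q0 :: "nat \<Rightarrow> cmat \<Rightarrow> cmat \<Rightarrow> complex" where
  "q0 n X Y = (\<Sum>a<n. \<Sum>b<n. X a b * cnj (Y a b)) - X n n * cnj (Y n n) / of_nat n"

definition q1 :: "nat \<Rightarrow> cmat \<Rightarrow> cmat \<Rightarrow> complex" where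
  "q1 n X Y = (of_nat n + 1) / of_nat n * (X n n * cnj (Y n n))"

definition q2 :: "nat \<Rightarrow> cmat \<Rightarrow> cmat \<Rightarrow> complex" where
  "q2 n X Y = (\<Sum>a<n. X a n * cnj (Y a n) + X n a * cnj (Y n a))"

lemma sl_trace_block: "X \<in> sl (Suc n) \<Longrightarrow> (\<Sum>a<n. X a a) = - X n n"
  by (simp add: sl_def add_eq_0_iff)

lemma proj_I_apply:
  assumes n: "0 < n" and X: "X \<in> sl (Suc n)"
  shows "proj_I n X i j = (if i = j \<and> i < n then - X n n / of_nat n else if i = j \<and> i = n then X n n else 0)"
proof -
  define c where "c = complex_of_real (sqrt (1 / (real n * (real n + 1))))"
  \<comment> \<open>The square root in \<open>Imat\<close> enters the projection only through its
    square.\<close>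
  have cc: "c * c = 1 / (of_nat n * (of_nat n + 1))"
  proof -
    have "c * c = of_real (sqrt (1 / (real n * (real n + 1))) * sqrt (1 / (real n * (real n + 1))))"
      unfolding c_def by (simp only: of_real_mult)
    also have "\<dots> = of_real (1 / (real n * (real n + 1)))"
      by (subst real_sqrt_mult_self) simp
    finally show ?thesis by simp
  qed
  have cnjc: "cnj c = c" by (simp add: c_def)
  define g where "g i = (if i < n then c else - of_nat n * c)" for i
  have Imat: "Imat n i j = (if j = i \<and> i < Suc n then g i else 0)" for i j
    by (auto simp: Imat_def g_def c_def)
  have "tr_inner (Suc n) X (Imat n) = (\<Sum>i<Suc n. \<Sum>j<Suc n. if j = i then X i i * cnj (g i) else 0)"
    unfolding tr_inner_def by (intro sum.cong refl) (simp add: Imat)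
  also have "\<dots> = (\<Sum>i<Suc n. X i i * cnj (g i))"
    by (intro sum.cong refl) simp
  also have "\<dots> = (\<Sum>i<n. X i i) * c - X n n * (of_nat n * c)"
    by (simp add: g_def sum_distrib_right cnjc)
  also have "\<dots> = - (of_nat n + 1) * c * X n n"
    by (simp add: sl_trace_block [OF X] algebra_simps)
  finally have "proj_I n X i j = - (of_nat n + 1) * X n n * (c * Imat n i j)"
    by (simp add: proj_I_def smul_def)
  moreover have "- (of_nat n + 1) * X n n * (c * c) = - X n n / of_nat n"
  proof -
    have "of_nat n + 1 \<noteq> (0::complex)"
      using of_nat_neq_0 [where 'a = complex, of n] by (simp add: add.commute)
    then have "(- X n n * (of_nat n + 1)) / (of_nat n * (of_nat n + 1)) = - X n n / of_nat n"
      by (rule mult_divide_mult_cancel_right)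
    then show ?thesis
      unfolding cc
      by (simp only: mult_minus_left times_divide_eq_right mult_1_right minus_divide_left mult.commute [of "X n n"])
  qed
  moreover from this have "- (of_nat n + 1) * X n n * (c * (- of_nat n * c)) = X n n"
    using n by (simp add: field_simps)
  ultimately show ?thesis
    by (auto simp: Imat g_def)
qed

text \<open>The upper-left block of \<open>X\<close> is its traceless part minus
  \<open>X n n / of_nat n\<close> times the identity. The first is scaled by \<open>1 / x\<close>;
  the second belongs to the line of \<open>Imat n\<close> and is scaled by \<open>1 / y\<close>.
  Hence the correction on the diagonal.\<close>

lemma sigma_apply:
  assumes n: "0 < n" and X: "X \<in> sl (Suc n)"
  shows "sigma n x y z X i j =
    (if i < n \<and> j < n then X i j * of_real (1 / x) + (if i = j then of_real (1 / x - 1 / y) * X n n / of_nat n else 0)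
     else if i = n \<and> j = n then X n n * of_real (1 / y)
     else X i j * of_real (1 / z))"
proof -
  have "X i j = 0" if "n < i \<or> n < j"
    using X that by (auto simp: sl_def mat_space_def)
  moreover define p r s where "p = complex_of_real (1 / x)" and "r = complex_of_real (1 / y)" and "s = complex_of_real (1 / z)"
  have "of_real (1 / x - 1 / y) = p - r" by (simp add: p_def r_def)
  ultimately show ?thesis
    using n unfolding sigma_def
    by (simp only: flip: p_def r_def s_def)
      (auto simp: madd_def smul_def proj_sln_def msub_def proj_s_def
        proj_I_apply [OF assms] field_simps not_less le_less)
qed

lemma sigma_sl:
  assumes n: "0 < n" and X: "X \<in> sl (Suc n)"
  shows "sigma n x y z X \<in> sl (Suc n)"
proof -
  have "(\<Sum>i<n. sigma n x y z X i i) = (\<Sum>i<n. X i i) * of_real (1 / x) + of_nat n * (of_real (1 / x - 1 / y) * X n n / of_nat n)"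
    by (simp add: sigma_apply [OF assms] sum.distrib sum_divide_distrib cong: sum.cong_simp)
  also have "\<dots> = - X n n * of_real (1 / y)"
    using n by (simp add: sl_trace_block [OF X]) (simp add: algebra_simps)
  finally have "(\<Sum>i<Suc n. sigma n x y z X i i) = 0"
    by (simp add: sigma_apply [OF assms])
  moreover have "sigma n x y z X i j = 0" if "Suc n \<le> i \<or> Suc n \<le> j" for i j
    using X that by (auto simp: sigma_apply [OF assms] sl_def mat_space_def)
  ultimately show ?thesis
    by (auto simp: sl_def mat_space_def)
qed

text \<open>The shape that \<open>sigma_apply\<close> gives to the block: a scaled matrix plus a
  multiple of the identity.\<close>

lemma block_sum_shift:
  "(\<Sum>a<n. \<Sum>b<n. (X a b * c + (if a = b then m else 0)) * cnj (Y a b * c' + (if a = b then m' else 0)))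
    = c * cnj c' * (\<Sum>a<n. \<Sum>b<n. X a b * cnj (Y a b)) + c * cnj m' * (\<Sum>a<n. X a a)
      + m * cnj c' * cnj (\<Sum>a<n. Y a a) + of_nat n * m * cnj m'"
proof -
  have "(X a b * c + (if a = b then m else 0)) * cnj (Y a b * c' + (if a = b then m' else 0))
    = c * cnj c' * (X a b * cnj (Y a b)) + (if b = a then c * cnj m' * X a a + m * cnj c' * cnj (Y a a) + m * cnj m' else 0)" for a b
    by (auto simp: algebra_simps)
  then show ?thesis
    by (simp add: sum.distrib sum_distrib_left cong: sum.cong_simp)
qed

lemma tr_inner_Suc:
  "tr_inner (Suc n) X Y = (\<Sum>a<n. \<Sum>b<n. X a b * cnj (Y a b)) + q2 n X Y + X n n * cnj (Y n n)"
  by (simp add: tr_inner_def q2_def sum.distrib)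

text \<open>\<open>q0\<close> sees only the component in the embedded \<open>sl n\<close>, on which
  \<open>sigma\<close> multiplies each argument by \<open>1 / x\<close>; the diagonal shift cancels
  against the corner term. The next two lemmas do the same for the other components.\<close>

lemma q0_sigma:
  assumes n: "0 < n" and X: "X \<in> sl (Suc n)" and Y: "Y \<in> sl (Suc n)"
  shows "q0 n (sigma n x y z X) (sigma n x y z Y) = of_real ((1 / x)\<^sup>2) * q0 n X Y"
proof -
  define p r where "p = complex_of_real (1 / x)" and "r = complex_of_real (1 / y)"
  have pr: "of_real (1 / x - 1 / y) = p - r" by (simp add: p_def r_def)
  have cnj: "cnj p = p" "cnj r = r" by (simp_all add: p_def r_def)
  have "q0 n (sigma n x y z X) (sigma n x y z Y) =
     (\<Sum>a<n. \<Sum>b<n. (X a b * p + (if a = b then (p - r) * X n n / of_nat n else 0))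
        * cnj (Y a b * p + (if a = b then (p - r) * Y n n / of_nat n else 0))) - X n n * r * cnj (Y n n * r) / of_nat n"
    unfolding q0_def by (simp only: sigma_apply [OF n X] sigma_apply [OF n Y] pr flip: p_def r_def cong: sum.cong_simp) simp
  also have "\<dots> = p * p * q0 n X Y"
    unfolding block_sum_shift using n
    by (simp add: q0_def sl_trace_block [OF X] sl_trace_block [OF Y] cnj) (simp add: field_simps)
  finally show ?thesis by (simp add: p_def power2_eq_square)
qed

lemma q1_sigma:
  assumes n: "0 < n" and X: "X \<in> sl (Suc n)" and Y: "Y \<in> sl (Suc n)"
  shows "q1 n (sigma n x y z X) (sigma n x y z Y) = of_real ((1 / y)\<^sup>2) * q1 n X Y"
  by (simp add: q1_def sigma_apply [OF n X] sigma_apply [OF n Y] power2_eq_square)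

lemma q2_sigma:
  assumes n: "0 < n" and X: "X \<in> sl (Suc n)" and Y: "Y \<in> sl (Suc n)"
  shows "q2 n (sigma n x y z X) (sigma n x y z Y) = of_real ((1 / z)\<^sup>2) * q2 n X Y"
  by (simp add: q2_def sigma_apply [OF n X] sigma_apply [OF n Y] power2_eq_square sum_distrib_left
      algebra_simps cong: sum.cong_simp)

text \<open>With this the time dependence of a \<sigma> metric sits in three real coefficients of
  fixed forms.\<close>

lemma sigma_metric_eq:
  assumes n: "0 < n" and X: "X \<in> sl (Suc n)" and Y: "Y \<in> sl (Suc n)"
  shows "sigma_metric n x y z X Y
    = of_real (1 / x) * q0 n X Y + of_real (1 / y) * q1 n X Y + of_real (1 / z) * q2 n X Y"
proof -
  define p r s where "p = complex_of_real (1 / x)" and "r = complex_of_real (1 / y)" and "s = complex_of_real (1 / z)"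
  have pr: "of_real (1 / x - 1 / y) = p - r" by (simp add: p_def r_def)
  have "q2 n (sigma n x y z X) Y = s * q2 n X Y"
    by (simp add: q2_def sigma_apply [OF n X] s_def sum_distrib_left algebra_simps cong: sum.cong_simp)
  moreover have "(\<Sum>a<n. \<Sum>b<n. sigma n x y z X a b * cnj (Y a b)) =
     (\<Sum>a<n. \<Sum>b<n. (X a b * p + (if a = b then (p - r) * X n n / of_nat n else 0))
        * cnj (Y a b * 1 + (if a = b then 0 else 0)))"
    by (simp only: sigma_apply [OF n X] pr flip: p_def r_def cong: sum.cong_simp) simp
  moreover have "sigma n x y z X n n = X n n * r"
    by (simp add: sigma_apply [OF n X] r_def)
  ultimately have "sigma_metric n x y z X Y = p * q0 n X Y + r * q1 n X Y + s * q2 n X Y"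
    unfolding sigma_metric_def tr_inner_Suc block_sum_shift using n
    by (simp add: q0_def q1_def sl_trace_block [OF X] sl_trace_block [OF Y]) (simp add: field_simps)
  then show ?thesis by (simp add: p_def r_def s_def)
qed

lemma herm_form_lincomb_q:
  "herm_form (Suc n) (\<lambda>X Y. of_real \<alpha> * q0 n X Y + of_real \<beta> * q1 n X Y + of_real \<gamma> * q2 n X Y)"
proof -
  have q: "sesq (Suc n) (q0 n)" "sesq (Suc n) (q1 n)" "sesq (Suc n) (q2 n)"
    by (simp_all add: sesq_def q0_def q1_def q2_def madd_def smul_def sum.distrib sum_distrib_left
      add_divide_distrib algebra_simps)
  have c: "cnj (q0 n X Y) = q0 n Y X" "cnj (q1 n X Y) = q1 n Y X" "cnj (q2 n X Y) = q2 n Y X" for X Y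
    by (simp_all add: q0_def q1_def q2_def mult.commute)
  have "sesq (Suc n) (\<lambda>X Y. of_real \<alpha> * q0 n X Y + of_real \<beta> * q1 n X Y + of_real \<gamma> * q2 n X Y)"
    using q by (simp add: sesq_def algebra_simps)
  then show ?thesis
    unfolding herm_form_def by (simp add: c)
qed

lemma herm_form_cong:
  assumes "herm_form N h" "\<And>X Y. X \<in> sl N \<Longrightarrow> Y \<in> sl N \<Longrightarrow> k X Y = h X Y"
  shows "herm_form N k"
proof -
  have "sesq N k"
    using herm_form_sesq [OF assms(1)] by (simp add: sesq_def assms(2) madd_sl smul_sl)
  moreover have "k Y X = cnj (k X Y)" if "X \<in> sl N" "Y \<in> sl N" for X Y
    using herm_form_cnj [OF assms(1) that] by (simp add: assms(2) that)
  ultimately show ?thesis unfolding herm_form_def by blast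
qed

lemma herm_form_sigma_metric: "0 < n \<Longrightarrow> herm_form (Suc n) (sigma_metric n x y z)"
  by (rule herm_form_cong [OF herm_form_lincomb_q]) (rule sigma_metric_eq)

text \<open>The corner weight, which may be negative, comes from \<open>munit (n, n)\<close> being, up to multiples of the
  identity, a multiple both of \<open>Imat n\<close> and of the identity of the block that is removed when the
  matrix units of the block are projected to trace zero.\<close>

definition wt :: "nat \<Rightarrow> real \<Rightarrow> real \<Rightarrow> real \<Rightarrow> nat \<Rightarrow> nat \<Rightarrow> real" where
  "wt n x y z a b = (if a < n \<and> b < n then x else if a = n \<and> b = n then (y * (real n + 1) - x) / real n else z)"

text \<open>Multiplying the entries of \<open>sigma n x y z X\<close> by the weights returns
  \<open>X\<close> plus \<open>\<kappa>\<close> times the identity, and the trace projection in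
  \<open>Eb\<close> removes that multiple. The corner weight is the value that produces the same
  \<open>\<kappa>\<close> in the corner as on the rest of the diagonal.\<close>

lemma frame_sigma_metric:
  assumes n: "0 < n" and pos: "0 < x" "0 < y" "0 < z"
  shows "frame (Suc n) (sigma_metric n x y z) (idx (Suc n)) (\<lambda>p. wt n x y z (fst p) (snd p)) (Eb (Suc n))"
proof -
  have "lincomb (idx (Suc n)) (\<lambda>p. of_real (wt n x y z (fst p) (snd p)) * sigma_metric n x y z X (Eb (Suc n) p)) (Eb (Suc n)) = X"
    if X: "X \<in> sl (Suc n)" for X
  proof -
    define M where "M i j = of_real (wt n x y z i j) * sigma n x y z X i j" for i j
    define \<kappa> where "\<kappa> = X n n / of_nat n - of_real (x / (real n * y)) * X n n"
    have tr: "(\<Sum>i<Suc n. sigma n x y z X i i) = 0"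
      using sigma_sl [OF n X] by (simp add: sl_def)
    have M: "M i j = X i j + (if i = j then \<kappa> else 0)" if "i < Suc n" "j < Suc n" for i j
      using that n pos by (auto simp: M_def \<kappa>_def wt_def sigma_apply [OF n X] less_Suc_eq field_simps)
    have trM: "(\<Sum>i<Suc n. M i i) = of_nat (Suc n) * \<kappa>"
    proof -
      have "(\<Sum>i<Suc n. M i i) = (\<Sum>i<Suc n. X i i + \<kappa>)"
        by (intro sum.cong refl) (simp add: M)
      also have "\<dots> = of_nat (Suc n) * \<kappa>"
        using X by (simp only: sum.distrib) (simp add: sl_def)
      finally show ?thesis .
    qed
    have "lincomb (idx (Suc n)) (\<lambda>p. of_real (wt n x y z (fst p) (snd p)) * sigma_metric n x y z X (Eb (Suc n) p)) (Eb (Suc n))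
      = lincomb (idx (Suc n)) (\<lambda>p. M (fst p) (snd p)) (Eb (Suc n))"
      unfolding lincomb_def
      by (intro ext sum.cong refl) (auto simp: M_def sigma_metric_def tr_inner_Eb [where A = "sigma n x y z X", OF _ _ tr])
    also have "\<dots> = X"
    proof (intro ext)
      fix i j
      have "X i j = 0" if "\<not> (i < Suc n \<and> j < Suc n)"
        using X that by (auto simp: sl_def mat_space_def)
      moreover have "of_nat (Suc n) * \<kappa> / of_nat (Suc n) = \<kappa>"
        by (metis nonzero_mult_div_cancel_left of_nat_eq_0_iff nat.distinct(1))
      ultimately show "lincomb (idx (Suc n)) (\<lambda>p. M (fst p) (snd p)) (Eb (Suc n)) i j = X i j"
        unfolding lincomb_Eb trM by (auto simp: M simp del: of_nat_Suc)
    qed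
    finally show ?thesis .
  qed
  then show ?thesis
    unfolding frame_def using Eb_sl by blast
qed

text \<open>Each bracket is a difference of two deltas. Products of like deltas give the sum over
  \<open>a\<close>, \<open>b\<close>, \<open>d\<close>, twice after relabelling by the symmetry of
  \<open>w\<close>. Mixed products satisfy both deltas and leave only diagonal entries of
  \<open>A\<close> and \<open>B\<close>. The common factor 2 will cancel the half in
  \<open>curv\<close>.\<close>

lemma sum_structure_constants:
  fixes w :: "nat \<Rightarrow> nat \<Rightarrow> complex"
  assumes sym: "\<And>a b. w a b = w b a"
  shows "(\<Sum>a<N. \<Sum>b<N. \<Sum>c<N. \<Sum>d<N. w a b * w c d *
      (((if b = c then A a d else 0) - (if a = d then A c b else 0)) *
       cnj ((if b = c then B a d else 0) - (if a = d then B c b else 0))))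
    = 2 * (\<Sum>a<N. \<Sum>d<N. (\<Sum>b<N. w a b * w b d) * (A a d * cnj (B a d)))
      - 2 * (\<Sum>a<N. \<Sum>b<N. (w a b)\<^sup>2 * (A a a * cnj (B b b)))"
proof -
  let ?f = "\<lambda>a b d. w a b * w b d * (A a d * cnj (B a d))"
  let ?g = "\<lambda>a b. (w a b)\<^sup>2 * (A a a * cnj (B b b))"
  have "w a b * w c d * (((if b = c then A a d else 0) - (if a = d then A c b else 0)) *
       cnj ((if b = c then B a d else 0) - (if a = d then B c b else 0)))
     = (if c = b then ?f a b d else 0) + (if d = a then ?f c a b else 0)
       - (if d = a then if c = b then ?g a b + ?g b a else 0 else 0)" for a b c d
    using sym by (auto simp: algebra_simps power2_eq_square)
  then have "(\<Sum>a<N. \<Sum>b<N. \<Sum>c<N. \<Sum>d<N. w a b * w c d *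
      (((if b = c then A a d else 0) - (if a = d then A c b else 0)) *
       cnj ((if b = c then B a d else 0) - (if a = d then B c b else 0))))
    = (\<Sum>a<N. \<Sum>b<N. \<Sum>c<N. \<Sum>d<N. if c = b then ?f a b d else 0)
      + (\<Sum>a<N. \<Sum>b<N. \<Sum>c<N. \<Sum>d<N. if d = a then ?f c a b else 0)
      - (\<Sum>a<N. \<Sum>b<N. \<Sum>c<N. \<Sum>d<N. if d = a then if c = b then ?g a b + ?g b a else 0 else 0)"
    by (simp only: sum.distrib sum_subtractf)
  also have "(\<Sum>a<N. \<Sum>b<N. \<Sum>c<N. \<Sum>d<N. if c = b then ?f a b d else 0) = (\<Sum>a<N. \<Sum>b<N. \<Sum>d<N. ?f a b d)"
  proof (rule sum.cong [OF refl], rule sum.cong [OF refl])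
    fix a b assume "b \<in> {..<N}"
    have "(\<Sum>c<N. \<Sum>d<N. if c = b then ?f a b d else 0) = (\<Sum>c<N. if c = b then (\<Sum>d<N. ?f a b d) else 0)"
      by (intro sum.cong refl) simp
    with \<open>b \<in> {..<N}\<close> show "(\<Sum>c<N. \<Sum>d<N. if c = b then ?f a b d else 0) = (\<Sum>d<N. ?f a b d)"
      by simp
  qed
  also have "\<dots> = (\<Sum>a<N. \<Sum>d<N. (\<Sum>b<N. w a b * w b d) * (A a d * cnj (B a d)))"
  proof (rule sum.cong [OF refl])
    fix a
    show "(\<Sum>b<N. \<Sum>d<N. ?f a b d) = (\<Sum>d<N. (\<Sum>b<N. w a b * w b d) * (A a d * cnj (B a d)))"
      by (subst sum.swap) (simp add: sum_distrib_right)
  qed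
  also have "(\<Sum>a<N. \<Sum>b<N. \<Sum>c<N. \<Sum>d<N. if d = a then ?f c a b else 0) = (\<Sum>a<N. \<Sum>b<N. \<Sum>c<N. ?f c a b)"
    by (intro sum.cong refl) simp
  also have "\<dots> = (\<Sum>a<N. \<Sum>c<N. \<Sum>b<N. ?f c a b)"
    by (rule sum.cong [OF refl]) (rule sum.swap)
  also have "\<dots> = (\<Sum>c<N. \<Sum>a<N. \<Sum>b<N. ?f c a b)"
    by (rule sum.swap)
  also have "\<dots> = (\<Sum>c<N. \<Sum>b<N. \<Sum>a<N. ?f c a b)"
    by (rule sum.cong [OF refl]) (rule sum.swap)
  also have "\<dots> = (\<Sum>a<N. \<Sum>d<N. (\<Sum>b<N. w a b * w b d) * (A a d * cnj (B a d)))"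
    by (simp add: sum_distrib_right)
  also have "(\<Sum>a<N. \<Sum>b<N. \<Sum>c<N. \<Sum>d<N. if d = a then if c = b then ?g a b + ?g b a else 0 else 0)
     = (\<Sum>a<N. \<Sum>b<N. ?g a b + ?g b a)"
    by (intro sum.cong refl) simp
  also have "\<dots> = 2 * (\<Sum>a<N. \<Sum>b<N. ?g a b)"
    using sum.swap [of "\<lambda>a b. ?g b a" "{..<N}" "{..<N}"] by (simp add: sum.distrib)
  finally show ?thesis by simp
qed

text \<open>For \<open>A\<close> and \<open>B\<close>, the images of \<open>X\<close> and
  \<open>Y\<close> under \<open>sigma\<close>, the metric pairs with brackets through the trace
  form, so the curvature is a weighted sum over entries of \<open>A\<close> and \<open>B\<close>.
  Returning to \<open>X\<close> and \<open>Y\<close> by \<open>q0_sigma\<close>,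
  \<open>q1_sigma\<close>, \<open>q2_sigma\<close> puts the squares into the denominators.\<close>

lemma curv_sigma:
  assumes n: "0 < n" and pos: "0 < x" "0 < y" "0 < z" and X: "X \<in> sl (Suc n)" and Y: "Y \<in> sl (Suc n)"
  shows "curv (Suc n) (sigma_metric n x y z) (idx (Suc n)) (\<lambda>p. wt n x y z (fst p) (snd p)) (Eb (Suc n)) X Y
    = of_real (real n + z\<^sup>2 / x\<^sup>2) * q0 n X Y + of_real ((real n + 1) * z\<^sup>2 / y\<^sup>2) * q1 n X Y
      + of_real ((real n + 1) / real n * ((real n - 1) * x + y) / z) * q2 n X Y"
proof -
  define N where "N = Suc n"
  define A B where "A = sigma n x y z X" and "B = sigma n x y z Y"
  define w where "w a b = complex_of_real (wt n x y z a b)" for a b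
  define v where "v = complex_of_real ((y * (real n + 1) - x) / real n)"
  define cx cz where "cx = complex_of_real x" and "cz = complex_of_real z"
  have AB: "A \<in> sl (Suc n)" "B \<in> sl (Suc n)"
    unfolding A_def B_def using sigma_sl n X Y by auto
  have kX: "sigma_metric n x y z X (bracket N (Eb N (a, b)) (Eb N (c, d)))
      = (if b = c then A a d else 0) - (if a = d then A c b else 0)"
    if "a < N" "b < N" "c < N" "d < N" for a b c d
    unfolding sigma_metric_def A_def N_def [symmetric] by (rule tr_inner_bracket_Eb [OF that])
  have kY: "sigma_metric n x y z (bracket N (Eb N (a, b)) (Eb N (c, d))) Y
      = cnj ((if b = c then B a d else 0) - (if a = d then B c b else 0))"
    if "a < N" "b < N" "c < N" "d < N" for a b c d
  proof -
    have "sigma_metric n x y z Y (bracket N (Eb N (a, b)) (Eb N (c, d)))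
      = (if b = c then B a d else 0) - (if a = d then B c b else 0)"
      unfolding sigma_metric_def B_def N_def [symmetric] by (rule tr_inner_bracket_Eb [OF that])
    then show ?thesis
      using herm_form_cnj [OF herm_form_sigma_metric [OF n] Y bracket_sl] by (metis N_def)
  qed
  have idx_sum: "(\<Sum>p\<in>idx N. \<Sum>q\<in>idx N. G (fst p) (snd p) (fst q) (snd q)) = (\<Sum>a<N. \<Sum>b<N. \<Sum>c<N. \<Sum>d<N. G a b c d)"
    for G :: "nat \<Rightarrow> nat \<Rightarrow> nat \<Rightarrow> nat \<Rightarrow> complex"
  proof -
    have pair: "(\<Sum>p\<in>idx N. H (fst p) (snd p)) = (\<Sum>a<N. \<Sum>b<N. H a b)" for H :: "nat \<Rightarrow> nat \<Rightarrow> complex"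
      by (simp add: sum.cartesian_product case_prod_beta)
    show ?thesis
      unfolding pair [of "\<lambda>c d. G a b c d" for a b] by (rule pair)
  qed
  have "curv N (sigma_metric n x y z) (idx N) (\<lambda>p. wt n x y z (fst p) (snd p)) (Eb N) X Y
    = (\<Sum>p\<in>idx N. \<Sum>q\<in>idx N. w (fst p) (snd p) * w (fst q) (snd q) *
      (((if snd p = fst q then A (fst p) (snd q) else 0) - (if fst p = snd q then A (fst q) (snd p) else 0)) *
       cnj ((if snd p = fst q then B (fst p) (snd q) else 0) - (if fst p = snd q then B (fst q) (snd p) else 0)))) / 2"
    unfolding curv_def
    by (intro arg_cong2 [where f = divide] sum.cong refl) (auto simp only: kX kY w_def mem_Times_iff fst_conv snd_conv lessThan_iff)
  also have "\<dots> = (\<Sum>a<N. \<Sum>d<N. (\<Sum>b<N. w a b * w b d) * (A a d * cnj (B a d)))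
      - (\<Sum>a<N. \<Sum>b<N. (w a b)\<^sup>2 * (A a a * cnj (B b b)))"
  proof -
    have "w a b = w b a" for a b by (auto simp: w_def wt_def)
    note * = sum_structure_constants [where w = w and N = N and A = A and B = B, OF this]
    show ?thesis
      unfolding idx_sum [of "\<lambda>a b c d. w a b * w c d *
        (((if b = c then A a d else 0) - (if a = d then A c b else 0)) *
         cnj ((if b = c then B a d else 0) - (if a = d then B c b else 0)))"] *
      by simp
  qed
  also have "(\<Sum>a<N. \<Sum>d<N. (\<Sum>b<N. w a b * w b d) * (A a d * cnj (B a d)))
     = (of_nat n * cx\<^sup>2 + cz\<^sup>2) * (\<Sum>a<n. \<Sum>d<n. A a d * cnj (B a d))
       + cz * (of_nat n * cx + v) * q2 n A B + (of_nat n * cz\<^sup>2 + v\<^sup>2) * (A n n * cnj (B n n))"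
  proof -
    \<comment> \<open>The middle index \<open>b\<close> runs over \<open>n\<close> block indices and
      the corner index \<open>n\<close>.\<close>
    have W: "(\<Sum>b<N. w a b * w b d) = (if a < n \<and> d < n then of_nat n * cx\<^sup>2 + cz\<^sup>2
      else if a = n \<and> d = n then of_nat n * cz\<^sup>2 + v\<^sup>2 else cz * (of_nat n * cx + v))"
      if "a \<le> n" "d \<le> n" for a d
      using that by (auto simp: N_def w_def wt_def cx_def cz_def v_def power2_eq_square algebra_simps le_less cong: sum.cong_simp)
    have "(\<Sum>a<N. \<Sum>d<N. (\<Sum>b<N. w a b * w b d) * (A a d * cnj (B a d))) =
      (\<Sum>a<N. \<Sum>d<N. (if a < n \<and> d < n then of_nat n * cx\<^sup>2 + cz\<^sup>2
      else if a = n \<and> d = n then of_nat n * cz\<^sup>2 + v\<^sup>2 else cz * (of_nat n * cx + v)) * (A a d * cnj (B a d)))"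
      by (intro sum.cong refl arg_cong2 [where f = times] W) (auto simp: N_def)
    also have "\<dots> = (of_nat n * cx\<^sup>2 + cz\<^sup>2) * (\<Sum>a<n. \<Sum>d<n. A a d * cnj (B a d))
       + cz * (of_nat n * cx + v) * q2 n A B + (of_nat n * cz\<^sup>2 + v\<^sup>2) * (A n n * cnj (B n n))"
      by (simp add: N_def q2_def sum.distrib sum_distrib_left distrib_left cong: sum.cong_simp)
    finally show ?thesis .
  qed
  \<comment> \<open>The weights are constant on the four blocks, and the trace of the block of
    \<open>A\<close> or \<open>B\<close> is minus its corner entry, so everything reduces to the
    corner.\<close>
  also have "(\<Sum>a<N. \<Sum>b<N. (w a b)\<^sup>2 * (A a a * cnj (B b b)))
     = (cx\<^sup>2 - 2 * cz\<^sup>2 + v\<^sup>2) * (A n n * cnj (B n n))"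
  proof -
    have "(\<Sum>a<N. \<Sum>b<N. (w a b)\<^sup>2 * (A a a * cnj (B b b)))
      = cx\<^sup>2 * ((\<Sum>a<n. A a a) * cnj (\<Sum>a<n. B a a)) + cz\<^sup>2 * ((\<Sum>a<n. A a a) * cnj (B n n))
        + cz\<^sup>2 * (A n n * cnj (\<Sum>a<n. B a a)) + v\<^sup>2 * (A n n * cnj (B n n))"
      by (simp add: N_def w_def wt_def cx_def cz_def v_def sum_product sum.distrib sum_distrib_left
          sum_distrib_right cong: sum.cong_simp) (rule sum.swap)
    then show ?thesis
      unfolding sl_trace_block [OF AB(1)] sl_trace_block [OF AB(2)] by (simp add: algebra_simps)
  qed
  \<comment> \<open>The square of the corner weight \<open>v\<close> cancels; what remains of the
    corner term splits between the corner parts of \<open>q0\<close> and \<open>q1\<close>.\<close>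
  also have "(of_nat n * cx\<^sup>2 + cz\<^sup>2) * (\<Sum>a<n. \<Sum>d<n. A a d * cnj (B a d))
       + cz * (of_nat n * cx + v) * q2 n A B + (of_nat n * cz\<^sup>2 + v\<^sup>2) * (A n n * cnj (B n n))
       - (cx\<^sup>2 - 2 * cz\<^sup>2 + v\<^sup>2) * (A n n * cnj (B n n))
     = (of_nat n * cx\<^sup>2 + cz\<^sup>2) * q0 n A B + (of_nat n + 1) * cz\<^sup>2 * q1 n A B
       + cz * (of_nat n * cx + v) * q2 n A B"
    using n by (simp add: q0_def q1_def field_simps)
  also have "\<dots> = of_real ((real n * x\<^sup>2 + z\<^sup>2) * (1 / x)\<^sup>2) * q0 n X Y
      + of_real ((real n + 1) * z\<^sup>2 * (1 / y)\<^sup>2) * q1 n X Y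
      + of_real (z * (real n * x + (y * (real n + 1) - x) / real n) * (1 / z)\<^sup>2) * q2 n X Y"
    unfolding A_def B_def q0_sigma [OF n X Y] q1_sigma [OF n X Y] q2_sigma [OF n X Y]
    by (simp add: cx_def cz_def v_def)
  also have "(real n * x\<^sup>2 + z\<^sup>2) * (1 / x)\<^sup>2 = real n + z\<^sup>2 / x\<^sup>2"
    using pos by (simp add: field_simps power2_eq_square)
  also have "(real n + 1) * z\<^sup>2 * (1 / y)\<^sup>2 = (real n + 1) * z\<^sup>2 / y\<^sup>2"
    by (simp add: power_divide)
  also have "z * (real n * x + (y * (real n + 1) - x) / real n) * (1 / z)\<^sup>2 = (real n + 1) / real n * ((real n - 1) * x + y) / z"
    using pos n by (simp add: field_simps power2_eq_square)
  finally show ?thesis unfolding N_def .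
qed

subsection \<open>Real analysis on an interval\<close>

lemma nonincreasing_within:
  fixes f :: "real \<Rightarrow> real"
  assumes "a \<le> b" "\<And>t. t \<in> {a..b} \<Longrightarrow> (f has_real_derivative f' t) (at t within {a..b})"
    "\<And>t. t \<in> {a..b} \<Longrightarrow> f' t \<le> 0"
  shows "f b \<le> f a"
proof -
  obtain t where "t \<in> {a..b}" "f b - f a = f' t * (b - a)"
    using mvt_very_simple [OF assms(1), of f "\<lambda>t. (*) (f' t)"] assms(2)
    by (auto simp: has_field_derivative_def)
  then show ?thesis
    using assms(1) assms(3) [of t] mult_nonpos_nonneg [of "f' t" "b - a"] by simp
qed

text \<open>The integrating factor \<open>exp (- L * t)\<close> makes the product with
  \<open>f\<close> nonincreasing, and it starts at zero.\<close>

lemma gronwall_zero: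
  fixes f :: "real \<Rightarrow> real"
  assumes "0 \<le> b" and deriv: "\<And>t. t \<in> {0..b} \<Longrightarrow> (f has_real_derivative f' t) (at t within {0..b})"
    and le: "\<And>t. t \<in> {0..b} \<Longrightarrow> f' t \<le> L * f t" and "f 0 = 0" "0 \<le> f b"
  shows "f b = 0"
proof -
  have "exp (- L * b) * f b \<le> exp (- L * 0) * f 0"
  proof (rule nonincreasing_within [OF \<open>0 \<le> b\<close>, where f' = "\<lambda>t. exp (- L * t) * (f' t - L * f t)"])
    fix t assume t: "t \<in> {0..b}"
    show "((\<lambda>t. exp (- L * t) * f t) has_real_derivative exp (- L * t) * (f' t - L * f t)) (at t within {0..b})"
      by (rule derivative_eq_intros deriv [OF t] refl)+ (simp add: algebra_simps)
    show "exp (- L * t) * (f' t - L * f t) \<le> 0"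
      using le [OF t] by (simp add: mult_nonneg_nonpos)
  qed
  then have "f b \<le> 0"
    using \<open>f 0 = 0\<close> by (simp add: mult_le_0_iff)
  with \<open>0 \<le> f b\<close> show ?thesis by simp
qed

lemma continuous_on_interval_bound:
  fixes f :: "real \<Rightarrow> real"
  assumes "continuous_on {a..b} f"
  shows "\<exists>B\<ge>1. \<forall>t\<in>{a..b}. \<bar>f t\<bar> \<le> B"
proof -
  have "bounded (f ` {a..b})"
    by (intro compact_imp_bounded compact_continuous_image assms compact_Icc)
  then obtain B where "\<forall>x\<in>f ` {a..b}. norm x \<le> B"
    unfolding bounded_iff by blast
  then show ?thesis
    by (intro exI [of _ "max 1 B"]) (auto simp: le_max_iff_disj)
qed

text \<open>\<open>smooth_real_on\<close> asks for a whole sequence of derivatives. Fixing one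
  derivative inside \<open>F\<close> for each member and iterating that choice supplies it.\<close>

lemma smooth_real_on_closed_family:
  assumes step: "\<And>f. f \<in> F \<Longrightarrow> \<exists>g\<in>F. \<forall>t\<in>S. (f has_real_derivative g t) (at t within S)" and f: "f \<in> F"
  shows "smooth_real_on S f"
proof -
  obtain d where d: "\<And>f. f \<in> F \<Longrightarrow> d f \<in> F" "\<And>f t. f \<in> F \<Longrightarrow> t \<in> S \<Longrightarrow> (f has_real_derivative d f t) (at t within S)"
    using step by metis
  have F: "(d ^^ k) f \<in> F" for k
    by (induction k) (auto simp: f d(1))
  show ?thesis
    unfolding smooth_real_on_def
    by (rule exI [of _ "\<lambda>k. (d ^^ k) f"]) (auto simp: d(2) [OF F])
qed

text \<open>Polynomial expressions in the functions of \<open>G\<close>. The right-hand sides of the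
  differential equations are polynomial in \<open>x\<close>, \<open>y\<close>, \<open>z\<close>, so
  this family is closed under differentiation along a solution.\<close>

inductive_set poly_family :: "(real \<Rightarrow> real) set \<Rightarrow> (real \<Rightarrow> real) set" for G where
  gen: "f \<in> G \<Longrightarrow> f \<in> poly_family G"
| const: "(\<lambda>_. c) \<in> poly_family G"
| add: "f \<in> poly_family G \<Longrightarrow> g \<in> poly_family G \<Longrightarrow> (\<lambda>t. f t + g t) \<in> poly_family G"
| mult: "f \<in> poly_family G \<Longrightarrow> g \<in> poly_family G \<Longrightarrow> (\<lambda>t. f t * g t) \<in> poly_family G"

lemma smooth_real_on_poly_family:
  assumes G: "\<And>f. f \<in> G \<Longrightarrow> \<exists>g\<in>poly_family G. \<forall>t\<in>S. (f has_real_derivative g t) (at t within S)"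
    and f: "f \<in> poly_family G"
  shows "smooth_real_on S f"
proof (rule smooth_real_on_closed_family [OF _ f])
  fix f assume "f \<in> poly_family G"
  then show "\<exists>g\<in>poly_family G. \<forall>t\<in>S. (f has_real_derivative g t) (at t within S)"
  proof induction
    case (gen f)
    then show ?case by (rule G)
  next
    case (const c)
    show ?case by (intro bexI [of _ "\<lambda>_. 0"] ballI poly_family.const) auto
  next
    case (add f g)
    then obtain f' g' where "f' \<in> poly_family G" "g' \<in> poly_family G"
      "\<forall>t\<in>S. (f has_real_derivative f' t) (at t within S)" "\<forall>t\<in>S. (g has_real_derivative g' t) (at t within S)"
      by blast
    then show ?case
      by (intro bexI [of _ "\<lambda>t. f' t + g' t"] ballI DERIV_add poly_family.add) auto
  next
    case (mult f g)
    then obtain f' g' where *: "f' \<in> poly_family G" "g' \<in> poly_family G"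
      "\<forall>t\<in>S. (f has_real_derivative f' t) (at t within S)" "\<forall>t\<in>S. (g has_real_derivative g' t) (at t within S)"
      by blast
    show ?case
    proof (intro bexI ballI)
      show "(\<lambda>t. f' t * g t + g' t * f t) \<in> poly_family G"
        by (intro poly_family.add poly_family.mult * mult)
      fix t assume "t \<in> S"
      then show "((\<lambda>t. f t * g t) has_real_derivative f' t * g t + g' t * f t) (at t within S)"
        by (intro DERIV_mult) (use * in auto)
    qed
  qed
qed

lemma has_real_derivative_cmod_square:
  assumes "(f has_vector_derivative f') (at x within S)"
  shows "((\<lambda>t. (cmod (f t))\<^sup>2) has_real_derivative 2 * inner (f x) f') (at x within S)"
proof -
  have ri: "((\<lambda>t. Re (f t)) has_real_derivative Re f') (at x within S)"
    "((\<lambda>t. Im (f t)) has_real_derivative Im f') (at x within S)"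
    using assms by (auto simp: has_vector_derivative_complex_iff)
  show ?thesis
    unfolding cmod_power2 using DERIV_add [OF DERIV_power [OF ri(1), of 2] DERIV_power [OF ri(2), of 2]]
    by (simp add: inner_complex_def algebra_simps)
qed

subsection \<open>The trajectory\<close>

text \<open>The matrix \<open>Imat n\<close> without its square root, as a test vector for the line
  it spans.\<close>

definition diag_vec :: "nat \<Rightarrow> cmat" where
  "diag_vec n = (\<lambda>i j. if i = j \<and> i \<le> n then (if i < n then 1 else - of_nat n) else 0)"

lemma munit_sl: "a < N \<Longrightarrow> b < N \<Longrightarrow> a \<noteq> b \<Longrightarrow> munit (a, b) \<in> sl N"
  by (auto simp: sl_def mat_space_def munit_def intro!: sum.neutral)

lemma diag_vec_sl: "diag_vec n \<in> sl (Suc n)"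
  by (auto simp: sl_def mat_space_def diag_vec_def)

lemma entries_le_munit: "1 \<le> C \<Longrightarrow> entries_le C (munit p)"
  by (auto simp: entries_le_def munit_def)

lemma entries_le_diag_vec: "1 \<le> C \<Longrightarrow> real n \<le> C \<Longrightarrow> entries_le C (diag_vec n)"
  by (auto simp: entries_le_def diag_vec_def)

text \<open>The three test vectors are dual to the three forms: each form is nonzero at exactly one
  of them. \<open>2 \<le> n\<close> puts the position \<open>(0, 1)\<close> inside the upper-left
  block.\<close>

lemma q_munit_block:
  assumes "2 \<le> n"
  shows "q0 n (munit (0, 1)) (munit (0, 1)) = 1" "q1 n (munit (0, 1)) (munit (0, 1)) = 0"
    "q2 n (munit (0, 1)) (munit (0, 1)) = 0"
  using assms tr_inner_munit [of 0 n 1 "munit (0, 1)"]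
  by (auto simp: q0_def q1_def q2_def munit_def)

lemma q_munit_col:
  assumes "2 \<le> n"
  shows "q0 n (munit (0, n)) (munit (0, n)) = 0" "q1 n (munit (0, n)) (munit (0, n)) = 0"
    "q2 n (munit (0, n)) (munit (0, n)) = 1"
proof -
  have "q2 n (munit (0, n)) (munit (0, n)) = (\<Sum>a<n. if a = 0 then 1 else 0)"
    using assms unfolding q2_def by (intro sum.cong) (auto simp: munit_def)
  then show "q2 n (munit (0, n)) (munit (0, n)) = 1" using assms by simp
qed (use assms in \<open>auto simp: q0_def q1_def munit_def intro!: sum.neutral\<close>)

lemma q_diag_vec:
  assumes "2 \<le> n"
  shows "q0 n (diag_vec n) (diag_vec n) = 0" "q1 n (diag_vec n) (diag_vec n) = of_real (real n * (real n + 1))"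
    "q2 n (diag_vec n) (diag_vec n) = 0"
proof -
  have "(\<Sum>a<n. \<Sum>b<n. diag_vec n a b * cnj (diag_vec n a b)) = (\<Sum>a<n. \<Sum>b<n. if b = a then 1 else 0)"
    by (intro sum.cong refl) (auto simp: diag_vec_def)
  also have "\<dots> = of_nat n" by simp
  finally show "q0 n (diag_vec n) (diag_vec n) = 0"
    using assms by (simp add: q0_def diag_vec_def)
qed (use assms in \<open>auto simp: q1_def q2_def diag_vec_def\<close>)

section \<open>A given solution, the candidate \<sigma> metric and their difference\<close>

locale phcf_solution =
  fixes n :: nat and x0 y0 z0 :: real and T :: ereal
    and h :: "real \<Rightarrow> cmat \<Rightarrow> cmat \<Rightarrow> complex" and J :: "real set"
  defines "J \<equiv> {t. 0 \<le> t \<and> ereal t < T}"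
  assumes n2: "2 \<le> n"
    and inner: "\<And>t. t \<in> J \<Longrightarrow> herm_inner (Suc n) (h t)"
    and init: "\<And>X Y. X \<in> sl (Suc n) \<Longrightarrow> Y \<in> sl (Suc n) \<Longrightarrow> h 0 X Y = sigma_metric n x0 y0 z0 X Y"
    and flow: "\<And>t X Y. t \<in> J \<Longrightarrow> X \<in> sl (Suc n) \<Longrightarrow> Y \<in> sl (Suc n) \<Longrightarrow>
       ((\<lambda>s. h s X Y) has_vector_derivative (- Theta (Suc n) (h t) X Y)) (at t within J)"
begin

abbreviation N :: nat where "N \<equiv> Suc n"

text \<open>On combinations of \<open>q0\<close>, \<open>q1\<close>, \<open>q2\<close> these three
  functionals return the real coefficients, see \<open>coef_lincomb\<close>. They are taken of
  arbitrary \<open>S\<close> because they are also applied to \<open>Theta\<close> and to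
  differences of curvatures.\<close>

definition coef0 :: "(cmat \<Rightarrow> cmat \<Rightarrow> complex) \<Rightarrow> real" where
  "coef0 S = Re (S (munit (0, 1)) (munit (0, 1)))"
definition coef1 :: "(cmat \<Rightarrow> cmat \<Rightarrow> complex) \<Rightarrow> real" where
  "coef1 S = Re (S (diag_vec n) (diag_vec n)) / (real n * (real n + 1))"
definition coef2 :: "(cmat \<Rightarrow> cmat \<Rightarrow> complex) \<Rightarrow> real" where
  "coef2 S = Re (S (munit (0, n)) (munit (0, n)))"

definition x :: "real \<Rightarrow> real" where "x t = 1 / coef0 (h t)"
definition y :: "real \<Rightarrow> real" where "y t = 1 / coef1 (h t)"
definition z :: "real \<Rightarrow> real" where "z t = 1 / coef2 (h t)"

definition k :: "real \<Rightarrow> cmat \<Rightarrow> cmat \<Rightarrow> complex" where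
  "k t = sigma_metric n (x t) (y t) (z t)"

definition kcurv :: "real \<Rightarrow> cmat \<Rightarrow> cmat \<Rightarrow> complex" where
  "kcurv t = curv N (k t) (idx N) (\<lambda>p. wt n (x t) (y t) (z t) (fst p) (snd p)) (Eb N)"

definition D :: "real \<Rightarrow> cmat \<Rightarrow> cmat \<Rightarrow> complex" where
  "D t X Y = h t X Y - k t X Y"

lemma test_sl: "munit (0, 1) \<in> sl N" "diag_vec n \<in> sl N" "munit (0, n) \<in> sl N"
  using n2 by (auto intro!: munit_sl diag_vec_sl)

lemma npos: "0 < n" using n2 by simp

lemma J_subset: "b \<in> J \<Longrightarrow> 0 \<le> a \<Longrightarrow> {a..b} \<subseteq> J"
  unfolding J_def by (auto intro: le_less_trans [of "ereal _" "ereal b"])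

lemma test_nonzero: "munit (0, 1) \<noteq> mzero" "diag_vec n \<noteq> mzero" "munit (0, n) \<noteq> mzero"
proof -
  have "munit (0, 1) 0 1 \<noteq> mzero 0 1" "diag_vec n 0 0 \<noteq> mzero 0 0" "munit (0, n) 0 n \<noteq> mzero 0 n"
    using n2 by (auto simp: munit_def diag_vec_def mzero_def)
  then show "munit (0, 1) \<noteq> mzero" "diag_vec n \<noteq> mzero" "munit (0, n) \<noteq> mzero"
    by metis+
qed

text \<open>Definiteness of \<open>h t\<close> at the test vectors. It makes the reciprocals
  \<open>x\<close>, \<open>y\<close>, \<open>z\<close> meaningful and positive at all times.\<close>

lemma coef_pos: "t \<in> J \<Longrightarrow> 0 < coef0 (h t)" "t \<in> J \<Longrightarrow> 0 < coef1 (h t)" "t \<in> J \<Longrightarrow> 0 < coef2 (h t)"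
  using herm_inner_pos [OF inner] test_sl test_nonzero npos
  by (auto simp: coef0_def coef1_def coef2_def)

lemma xyz_pos: "t \<in> J \<Longrightarrow> 0 < x t" "t \<in> J \<Longrightarrow> 0 < y t" "t \<in> J \<Longrightarrow> 0 < z t"
  by (simp_all add: x_def y_def z_def coef_pos)

lemma flow_Re: "t \<in> J \<Longrightarrow> X \<in> sl N \<Longrightarrow> Y \<in> sl N \<Longrightarrow>
    ((\<lambda>s. Re (h s X Y)) has_real_derivative - Re (Theta N (h t) X Y)) (at t within J)"
  using flow [of t X Y] by (simp add: has_vector_derivative_complex_iff)

lemma coef_deriv:
  assumes "t \<in> J"
  shows "((\<lambda>s. coef0 (h s)) has_real_derivative - coef0 (Theta N (h t))) (at t within J)"
    "((\<lambda>s. coef1 (h s)) has_real_derivative - coef1 (Theta N (h t))) (at t within J)"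
    "((\<lambda>s. coef2 (h s)) has_real_derivative - coef2 (Theta N (h t))) (at t within J)"
  unfolding coef0_def coef1_def coef2_def minus_divide_left
  by (intro flow_Re DERIV_cdivide assms test_sl)+

lemma k_eq: "X \<in> sl N \<Longrightarrow> Y \<in> sl N \<Longrightarrow> k t X Y
    = of_real (coef0 (h t)) * q0 n X Y + of_real (coef1 (h t)) * q1 n X Y + of_real (coef2 (h t)) * q2 n X Y"
  unfolding k_def by (simp add: sigma_metric_eq [OF npos] x_def y_def z_def)

lemma herm_form_k: "herm_form N (k t)"
  unfolding k_def by (rule herm_form_sigma_metric [OF npos])

lemma herm_form_h: "t \<in> J \<Longrightarrow> herm_form N (h t)"
  by (intro herm_inner_imp_herm_form inner)

lemma sesq_D: "t \<in> J \<Longrightarrow> sesq N (D t)"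
  unfolding D_def by (intro sesq_diff herm_form_sesq herm_form_h herm_form_k)

lemma frame_k: "t \<in> J \<Longrightarrow> frame N (k t) (idx N) (\<lambda>p. wt n (x t) (y t) (z t) (fst p) (snd p)) (Eb N)"
  unfolding k_def by (intro frame_sigma_metric npos xyz_pos)

lemma coef_lincomb:
  assumes "\<And>X Y. X \<in> sl N \<Longrightarrow> Y \<in> sl N \<Longrightarrow> S X Y = of_real a * q0 n X Y + of_real b * q1 n X Y + of_real c * q2 n X Y"
  shows "coef0 S = a" "coef1 S = b" "coef2 S = c"
  using npos by (simp_all add: coef0_def coef1_def coef2_def assms test_sl
    q_munit_block [OF n2] q_munit_col [OF n2] q_diag_vec [OF n2] del: One_nat_def)

lemma kcurv_eq:
  assumes "t \<in> J" "X \<in> sl N" "Y \<in> sl N"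
  shows "kcurv t X Y = of_real (real n + (z t)\<^sup>2 / (x t)\<^sup>2) * q0 n X Y
      + of_real ((real n + 1) * (z t)\<^sup>2 / (y t)\<^sup>2) * q1 n X Y
      + of_real ((real n + 1) / real n * ((real n - 1) * x t + y t) / z t) * q2 n X Y"
  unfolding kcurv_def k_def by (rule curv_sigma [OF npos xyz_pos [OF assms(1)] assms(2,3)])

lemma coef_kcurv:
  assumes "t \<in> J"
  shows "coef0 (kcurv t) = real n + (z t)\<^sup>2 / (x t)\<^sup>2" "coef1 (kcurv t) = (real n + 1) * (z t)\<^sup>2 / (y t)\<^sup>2"
    "coef2 (kcurv t) = (real n + 1) / real n * ((real n - 1) * x t + y t) / z t"
  by (rule coef_lincomb [OF kcurv_eq [OF assms]]; assumption)+

text \<open>The invariance of the \<sigma> family enters the comparison here: the curvature of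
  \<open>k t\<close> is recovered from its values at the test vectors.\<close>

lemma kcurv_expand:
  assumes "t \<in> J" "X \<in> sl N" "Y \<in> sl N"
  shows "kcurv t X Y = of_real (coef0 (kcurv t)) * q0 n X Y + of_real (coef1 (kcurv t)) * q1 n X Y
     + of_real (coef2 (kcurv t)) * q2 n X Y"
  unfolding coef_kcurv [OF assms(1)] by (rule kcurv_eq [OF assms])

lemma D_deriv:
  assumes t: "t \<in> J" and X: "X \<in> sl N" and Y: "Y \<in> sl N"
  defines "G \<equiv> \<lambda>X Y. Theta N (h t) X Y - kcurv t X Y"
  shows "((\<lambda>s. D s X Y) has_vector_derivative
     of_real (coef0 G) * q0 n X Y + of_real (coef1 G) * q1 n X Y + of_real (coef2 G) * q2 n X Y - G X Y) (at t within J)"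
proof -
  have vec: "((\<lambda>s. of_real (f s) * c) has_vector_derivative of_real f' * c) F"
    if "(f has_real_derivative f') F" for f f' F and c :: complex
    by (intro has_vector_derivative_mult_left has_vector_derivative_of_real)
       (use that in \<open>simp add: has_real_derivative_iff_has_vector_derivative\<close>)
  have cG: "coef0 G = coef0 (Theta N (h t)) - coef0 (kcurv t)" "coef1 G = coef1 (Theta N (h t)) - coef1 (kcurv t)"
    "coef2 G = coef2 (Theta N (h t)) - coef2 (kcurv t)"
    by (simp_all add: G_def coef0_def coef1_def coef2_def diff_divide_distrib)
  \<comment> \<open>By \<open>kcurv_expand\<close> the two contributions of \<open>kcurv t\<close>
    cancel, so it may be inserted into \<open>G\<close> at no cost.\<close>
  have *: "of_real (coef0 G) * q0 n X Y + of_real (coef1 G) * q1 n X Y + of_real (coef2 G) * q2 n X Y - G X Y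
    = - Theta N (h t) X Y - (of_real (- coef0 (Theta N (h t))) * q0 n X Y + of_real (- coef1 (Theta N (h t))) * q1 n X Y
        + of_real (- coef2 (Theta N (h t))) * q2 n X Y)"
    unfolding cG using kcurv_expand [OF t X Y] by (simp add: G_def algebra_simps)
  show ?thesis
    unfolding * D_def k_eq [OF X Y]
    by (intro has_vector_derivative_diff has_vector_derivative_add vec coef_deriv flow t X Y)
qed

lemma D_0: "X \<in> sl N \<Longrightarrow> Y \<in> sl N \<Longrightarrow> D 0 X Y = 0"
  using coef_lincomb [of "h 0" "1 / x0" "1 / y0" "1 / z0"]
  by (simp add: D_def k_eq init sigma_metric_eq [OF npos])

lemma continuous_on_h: "X \<in> sl N \<Longrightarrow> Y \<in> sl N \<Longrightarrow> continuous_on J (\<lambda>t. h t X Y)"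
  unfolding continuous_on_eq_continuous_within
  using flow has_vector_derivative_continuous by blast

lemma continuous_on_coef:
  "continuous_on J (\<lambda>t. coef0 (h t))" "continuous_on J (\<lambda>t. coef1 (h t))" "continuous_on J (\<lambda>t. coef2 (h t))"
  by (rule DERIV_continuous_on, erule coef_deriv)+

lemma continuous_on_xyz: "continuous_on J x" "continuous_on J y" "continuous_on J z"
proof -
  have "coef0 (h t) \<noteq> 0" "coef1 (h t) \<noteq> 0" "coef2 (h t) \<noteq> 0" if "t \<in> J" for t
    using coef_pos [OF that] by auto
  then show "continuous_on J x" "continuous_on J y" "continuous_on J z"
    unfolding x_def [abs_def] y_def [abs_def] z_def [abs_def]
    by (intro continuous_intros continuous_on_coef; blast)+
qed

lemma continuous_on_k: "X \<in> sl N \<Longrightarrow> Y \<in> sl N \<Longrightarrow> continuous_on J (\<lambda>t. k t X Y)"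
  by (simp only: k_eq) (intro continuous_intros continuous_on_coef)

text \<open>Since the curvature form is nonnegative, the final metric bounds all earlier ones from below.\<close>

lemma h_self_antimono:
  assumes b: "b \<in> J" and t: "0 \<le> t" "t \<le> b" and X: "X \<in> sl N"
  shows "Re (h b X X) \<le> Re (h t X X)"
proof -
  have sub: "{t..b} \<subseteq> J" using J_subset b t by blast
  show ?thesis
  proof (rule nonincreasing_within [OF t(2), where f = "\<lambda>s. Re (h s X X)"])
    fix s assume s: "s \<in> {t..b}"
    show "((\<lambda>s. Re (h s X X)) has_real_derivative - Re (Theta N (h s) X X)) (at s within {t..b})"
      using flow_Re [of s X X] sub s X has_field_derivative_subset by blast
    show "- Re (Theta N (h s) X X) \<le> 0"
      using Theta_self_nonneg [OF inner X, of s] sub s by auto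
  qed
qed

text \<open>The unitary basis of \<open>h t\<close> is chosen anew for each \<open>t\<close>, so the
  bounds must hold for whichever basis comes. A unit vector of \<open>h t\<close> has length at most
  1 for the final metric \<open>h b\<close>, which bounds its entries by a fixed \<open>C0\<close>.
  The norms of the forms and the weights are bounded by continuity on the compact interval.\<close>

lemma Theta_kcurv_lipschitz:
  assumes b: "b \<in> J"
  shows "\<exists>K\<ge>0. \<forall>t\<in>{0..b}. \<forall>X\<in>sl N. \<forall>Y\<in>sl N. entries_le (real n + 2) X \<longrightarrow> entries_le (real n + 2) Y \<longrightarrow>
     cmod (Theta N (h t) X Y - kcurv t X Y) \<le> K * form_norm N (D t)"
proof -
  have sub: "{0..b} \<subseteq> J" using J_subset b by blast
  obtain C0 where C0: "0 \<le> C0" "\<And>X. X \<in> sl N \<Longrightarrow> entries_le (C0 * sqrt (Re (h b X X))) X"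
    using herm_inner_entry_bound [OF inner [OF b]] by blast
  \<comment> \<open>The summand \<open>real n + 2\<close> lets \<open>C\<close> also dominate the
    entries of \<open>X\<close>, \<open>Y\<close> and \<open>Eb\<close>.\<close>
  define C where "C = C0 + real n + 2"
  have cont_norm: "continuous_on {0..b} (\<lambda>t. form_norm N (h t))" "continuous_on {0..b} (\<lambda>t. form_norm N (k t))"
    unfolding form_norm_def
    by (intro continuous_intros continuous_on_subset [OF continuous_on_h sub] continuous_on_subset [OF continuous_on_k sub] Eb_sl; assumption)+
  obtain H1 where H1: "1 \<le> H1" "\<And>t. t \<in> {0..b} \<Longrightarrow> \<bar>form_norm N (h t)\<bar> \<le> H1"
    using continuous_on_interval_bound [OF cont_norm(1)] by blast
  obtain H2 where H2: "1 \<le> H2" "\<And>t. t \<in> {0..b} \<Longrightarrow> \<bar>form_norm N (k t)\<bar> \<le> H2"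
    using continuous_on_interval_bound [OF cont_norm(2)] by blast
  define H where "H = H1 + H2"
  \<comment> \<open>This sum dominates all three values of \<open>wt\<close>, including the absolute
    value of the corner weight.\<close>
  have "continuous_on {0..b} (\<lambda>t. x t + z t + y t * (real n + 1))"
    by (intro continuous_intros continuous_on_xyz [THEN continuous_on_subset] sub)
  then obtain V where V: "1 \<le> V" "\<And>t. t \<in> {0..b} \<Longrightarrow> \<bar>x t + z t + y t * (real n + 1)\<bar> \<le> V"
    using continuous_on_interval_bound by blast
  define B where "B = C * (2 * real N * C * C)"
  define K where "K = real (N * N) ^ 3 * V ^ 3 * C\<^sup>2 * (B * H)\<^sup>2 + real (N * N) ^ 2 * V ^ 2 * B\<^sup>2 * H"
  have "0 \<le> K"
    using V H1 H2 by (simp add: K_def H_def)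
  moreover have "cmod (Theta N (h t) X Y - kcurv t X Y) \<le> K * form_norm N (D t)"
    if t: "t \<in> {0..b}" and X: "X \<in> sl N" "entries_le (real n + 2) X" and Y: "Y \<in> sl N" "entries_le (real n + 2) Y" for t X Y
  proof -
    have tJ: "t \<in> J" using t sub by blast
    obtain d e where d: "d \<le> N * N" and u: "unitary_basis N (h t) d e"
      using unitary_basis_exists [OF inner [OF tJ]] by blast
    have mono: "entries_le C X" if "entries_le c X" "c \<le> C" for c X
      using that by (auto simp: entries_le_def intro: order_trans)
    have e: "entries_le C (e m)" if "m < d" for m
    proof (rule mono)
      have em: "e m \<in> sl N" "h t (e m) (e m) = 1"
        using u that by (auto simp: unitary_basis_def)
      show "entries_le (C0 * sqrt (Re (h b (e m) (e m)))) (e m)"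
        by (rule C0(2) [OF em(1)])
      have "Re (h b (e m) (e m)) \<le> 1"
        using h_self_antimono [OF b _ _ em(1), of t] t em(2) by simp
      then have "C0 * sqrt (Re (h b (e m) (e m))) \<le> C0 * 1"
        using C0(1) by (intro mult_left_mono) auto
      then show "C0 * sqrt (Re (h b (e m) (e m))) \<le> C"
        by (simp add: C_def)
    qed
    have w: "\<bar>wt n (x t) (y t) (z t) a c\<bar> \<le> V" for a c
    proof -
      note p = xyz_pos [OF tJ]
      have "\<bar>(y t * (real n + 1) - x t) / real n\<bar> \<le> \<bar>y t * (real n + 1) - x t\<bar> / 1"
        unfolding abs_divide using npos by (intro divide_left_mono) auto
      also have "\<dots> \<le> y t * (real n + 1) + x t"
        using p abs_triangle_ineq4 [of "y t * (real n + 1)" "x t"] by (simp add: abs_mult)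
      finally have "\<bar>wt n (x t) (y t) (z t) a c\<bar> \<le> x t + z t + y t * (real n + 1)"
        using p by (auto simp: wt_def intro!: add_nonneg_nonneg mult_nonneg_nonneg)
      then show ?thesis using V(2) [OF t] by simp
    qed
    have "cmod (curv N (h t) {..<d} (\<lambda>_. 1) e X Y - kcurv t X Y) \<le> K * form_norm N (\<lambda>X Y. h t X Y - k t X Y)"
      unfolding kcurv_def K_def B_def
    proof (rule curv_lipschitz)
      show "herm_form N (h t)" "frame N (h t) {..<d} (\<lambda>_. 1) e" "herm_form N (k t)"
        "frame N (k t) (idx N) (\<lambda>p. wt n (x t) (y t) (z t) (fst p) (snd p)) (Eb N)"
        using herm_form_h [OF tJ] unitary_basis_imp_frame [OF _ u] herm_form_k frame_k [OF tJ] by auto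
      show "entries_le C X" "entries_le C Y"
        by (rule mono [OF X(2)] mono [OF Y(2)], simp add: C_def C0(1))+
      show "entries_le C (Eb N m)" for m
        by (rule mono [OF entries_le_Eb]) (simp add: C_def C0(1))
      show "form_norm N (h t) \<le> H" "form_norm N (k t) \<le> H"
        using H1 H2 H1(2) [OF t] H2(2) [OF t] by (auto simp: H_def)
    qed (use X Y e w d V C0 in \<open>auto simp: C_def card_cartesian_product\<close>)
    then show ?thesis
      unfolding Theta_eq_curv [OF inner [OF tJ] u X(1) Y(1)] D_def [abs_def] .
  qed
  ultimately show ?thesis by blast
qed

text \<open>Gronwall for the sum of squares \<open>\<phi>\<close>: its derivative pairs
  \<open>D\<close> with \<open>D'\<close>, the Lipschitz estimate bounds \<open>D'\<close> by a
  multiple of the norm of \<open>D\<close>, and Cauchy-Schwarz leads back to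
  \<open>\<phi>\<close>.\<close>

lemma D_zero:
  assumes b: "b \<in> J" and X: "X \<in> sl N" and Y: "Y \<in> sl N"
  shows "D b X Y = 0"
proof -
  have sub: "{0..b} \<subseteq> J" using J_subset b by blast
  have b0: "0 \<le> b" using b by (simp add: J_def)
  obtain K where K: "0 \<le> K" "\<And>t X Y. t \<in> {0..b} \<Longrightarrow> X \<in> sl N \<Longrightarrow> Y \<in> sl N \<Longrightarrow>
      entries_le (real n + 2) X \<Longrightarrow> entries_le (real n + 2) Y \<Longrightarrow>
     cmod (Theta N (h t) X Y - kcurv t X Y) \<le> K * form_norm N (D t)"
    using Theta_kcurv_lipschitz [OF b] by blast
  define \<phi> where "\<phi> t = (\<Sum>p\<in>idx N. \<Sum>q\<in>idx N. (cmod (D t (Eb N p) (Eb N q)))\<^sup>2)" for t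
  define G where "G t X Y = Theta N (h t) X Y - kcurv t X Y" for t X Y
  define D' where "D' t X Y = of_real (coef0 (G t)) * q0 n X Y + of_real (coef1 (G t)) * q1 n X Y
    + of_real (coef2 (G t)) * q2 n X Y - G t X Y" for t X Y
  \<comment> \<open>\<open>R p q\<close> is the factor by which a bound on \<open>G\<close> grows in
    \<open>D'\<close>: 1 for \<open>G\<close> itself and one summand for each of the forms
    multiplying its coefficients.\<close>
  define R where "R p q = 1 + cmod (q0 n (Eb N p) (Eb N q)) + cmod (q1 n (Eb N p) (Eb N q)) + cmod (q2 n (Eb N p) (Eb N q))" for p q
  define Q where "Q = (\<Sum>p\<in>idx N. \<Sum>q\<in>idx N. R p q)"
  have R0: "0 \<le> R p q" for p q by (simp add: R_def)
  have RQ: "R p q \<le> Q" if "p \<in> idx N" "q \<in> idx N" for p q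
  proof -
    have "R p q \<le> (\<Sum>q\<in>idx N. R p q)"
      using that R0 by (intro member_le_sum) auto
    also have "\<dots> \<le> Q"
      unfolding Q_def using that R0 by (intro member_le_sum [of p "idx N" "\<lambda>p. \<Sum>q\<in>idx N. R p q"]) (auto intro!: sum_nonneg)
    finally show ?thesis .
  qed
  have D'_bound: "cmod (D' t (Eb N p) (Eb N q)) \<le> K * Q * form_norm N (D t)"
    if t: "t \<in> {0..b}" and p: "p \<in> idx N" and q: "q \<in> idx N" for t p q
  proof -
    define \<delta> where "\<delta> = K * form_norm N (D t)"
    have \<delta>0: "0 \<le> \<delta>" using K(1) by (simp add: \<delta>_def form_norm_nonneg)
    have G: "cmod (G t X Y) \<le> \<delta>" if "X \<in> sl N" "Y \<in> sl N" "entries_le (real n + 2) X" "entries_le (real n + 2) Y" for X Y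
      unfolding G_def \<delta>_def by (rule K(2) [OF t that])
    \<comment> \<open>The bound \<open>real n + 2\<close> leaves room both for \<open>Eb\<close>,
      with entries up to 2, and for \<open>diag_vec n\<close>, with entries up to
      \<open>n\<close>.\<close>
    have Eb: "entries_le (real n + 2) (Eb N p)" for p
      using entries_le_Eb [of N p] by (fastforce simp: entries_le_def intro: order_trans)
    have c0: "\<bar>coef0 (G t)\<bar> \<le> \<delta>" and c2: "\<bar>coef2 (G t)\<bar> \<le> \<delta>"
      unfolding coef0_def coef2_def
      by (intro order_trans [OF abs_Re_le_cmod] G test_sl entries_le_munit; simp)+
    have c1: "\<bar>coef1 (G t)\<bar> \<le> \<delta>"
    proof -
      have "\<bar>coef1 (G t)\<bar> \<le> \<bar>Re (G t (diag_vec n) (diag_vec n))\<bar> / 1"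
        unfolding coef1_def abs_divide using npos
        by (intro divide_left_mono) (auto simp: abs_mult intro!: mult_ge1_I)
      also have "\<dots> \<le> cmod (G t (diag_vec n) (diag_vec n))"
        by (simp add: abs_Re_le_cmod)
      also have "\<dots> \<le> \<delta>"
        by (intro G test_sl entries_le_diag_vec; simp)
      finally show ?thesis .
    qed
    have "cmod (D' t (Eb N p) (Eb N q)) \<le> cmod (of_real (coef0 (G t)) * q0 n (Eb N p) (Eb N q))
      + cmod (of_real (coef1 (G t)) * q1 n (Eb N p) (Eb N q)) + cmod (of_real (coef2 (G t)) * q2 n (Eb N p) (Eb N q))
      + cmod (G t (Eb N p) (Eb N q))"
      unfolding D'_def
      by (intro norm_triangle_le_diff add_right_mono norm_triangle_le order_refl)
    also have "\<dots> \<le> \<delta> * cmod (q0 n (Eb N p) (Eb N q)) + \<delta> * cmod (q1 n (Eb N p) (Eb N q))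
       + \<delta> * cmod (q2 n (Eb N p) (Eb N q)) + \<delta>"
      unfolding norm_mult norm_of_real
      by (intro add_mono mult_right_mono c0 c1 c2 G Eb_sl p q Eb norm_ge_zero)
    also have "\<dots> = \<delta> * R p q" by (simp add: R_def algebra_simps)
    also have "\<dots> \<le> \<delta> * Q" by (intro mult_left_mono RQ p q \<delta>0)
    finally show ?thesis by (simp add: \<delta>_def mult_ac)
  qed
  have "\<phi> b = 0"
  proof (rule gronwall_zero [OF b0, where L = "2 * (K * Q) * real (card (idx N \<times> idx N))"])
    fix t assume t: "t \<in> {0..b}"
    then have tJ: "t \<in> J" using sub by blast
    show "(\<phi> has_real_derivative (\<Sum>p\<in>idx N. \<Sum>q\<in>idx N. 2 * inner (D t (Eb N p) (Eb N q)) (D' t (Eb N p) (Eb N q)))) (at t within {0..b})"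
      unfolding \<phi>_def [abs_def]
    proof (intro DERIV_sum has_real_derivative_cmod_square)
      fix p q assume "p \<in> idx N" "q \<in> idx N"
      then have "((\<lambda>s. D s (Eb N p) (Eb N q)) has_vector_derivative D' t (Eb N p) (Eb N q)) (at t within J)"
        unfolding D'_def G_def [abs_def] by (intro D_deriv tJ Eb_sl)
      then show "((\<lambda>s. D s (Eb N p) (Eb N q)) has_vector_derivative D' t (Eb N p) (Eb N q)) (at t within {0..b})"
        using sub by (rule has_vector_derivative_within_subset)
    qed
    have "(\<Sum>p\<in>idx N. \<Sum>q\<in>idx N. 2 * inner (D t (Eb N p) (Eb N q)) (D' t (Eb N p) (Eb N q)))
       \<le> (\<Sum>p\<in>idx N. \<Sum>q\<in>idx N. 2 * (cmod (D t (Eb N p) (Eb N q)) * (K * Q * form_norm N (D t))))"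
    proof (intro sum_mono mult_left_mono)
      fix p q assume "p \<in> idx N" "q \<in> idx N"
      then show "inner (D t (Eb N p) (Eb N q)) (D' t (Eb N p) (Eb N q)) \<le> cmod (D t (Eb N p) (Eb N q)) * (K * Q * form_norm N (D t))"
        by (intro order_trans [OF norm_cauchy_schwarz] mult_left_mono D'_bound t norm_ge_zero)
    qed simp
    also have "\<dots> = 2 * (K * Q * form_norm N (D t)) * (\<Sum>p\<in>idx N. \<Sum>q\<in>idx N. cmod (D t (Eb N p) (Eb N q)))"
      by (simp add: sum_distrib_left mult_ac)
    also have "\<dots> = (2 * (K * Q)) * (form_norm N (D t))\<^sup>2"
      by (simp add: form_norm_def [symmetric] power2_eq_square)
    also have "\<dots> \<le> (2 * (K * Q)) * (real (card (idx N \<times> idx N)) * \<phi> t)"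
      unfolding \<phi>_def using K(1) R0 by (intro mult_left_mono form_norm_square_le) (auto simp: Q_def intro!: sum_nonneg mult_nonneg_nonneg)
    finally show "(\<Sum>p\<in>idx N. \<Sum>q\<in>idx N. 2 * inner (D t (Eb N p) (Eb N q)) (D' t (Eb N p) (Eb N q)))
       \<le> 2 * (K * Q) * real (card (idx N \<times> idx N)) * \<phi> t"
      by (simp add: mult_ac)
  next
    show "\<phi> 0 = 0" unfolding \<phi>_def by (simp add: D_0 Eb_sl)
    show "0 \<le> \<phi> b" unfolding \<phi>_def by (intro sum_nonneg) auto
  qed
  then have zero: "form_norm N (D b) = 0"
    using form_norm_square_le [of N "D b"] unfolding \<phi>_def by simp
  \<comment> \<open>A member of \<open>sl N\<close> has finitely many nonzero entries, so it has
    some entry bound and \<open>sesq_bound\<close> carries the vanishing over to it.\<close>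
  have "\<exists>a. entries_le a X" if "X \<in> sl N" for X
  proof
    have "cmod (X i j) \<le> (\<Sum>p\<in>idx N. cmod (X (fst p) (snd p)))" for i j
    proof (cases "(i, j) \<in> idx N")
      case True
      then show ?thesis
        using member_le_sum [of "(i, j)" "idx N" "\<lambda>p. cmod (X (fst p) (snd p))"] by simp
    next
      case False
      then have "X i j = 0" using that by (auto simp: sl_def mat_space_def)
      then show ?thesis by (simp add: sum_nonneg)
    qed
    then show "entries_le (\<Sum>p\<in>idx N. cmod (X (fst p) (snd p))) X"
      by (simp add: entries_le_def)
  qed
  then obtain a c where "entries_le a X" "entries_le c Y" using X Y by meson
  then have "cmod (D b X Y) \<le> a * c * form_norm N (D b)"
    by (intro sesq_bound sesq_D b X Y)
  with zero show ?thesis by simp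
qed

section \<open>The differential equations, initial values and smoothness\<close>

lemma h_eq_sigma_metric:
  "t \<in> J \<Longrightarrow> X \<in> sl N \<Longrightarrow> Y \<in> sl N \<Longrightarrow> h t X Y = sigma_metric n (x t) (y t) (z t) X Y"
  using D_zero [of t X Y] by (simp add: D_def k_def)

lemma Theta_eq_kcurv:
  assumes t: "t \<in> J" and X: "X \<in> sl N" and Y: "Y \<in> sl N"
  shows "Theta N (h t) X Y = kcurv t X Y"
proof -
  obtain d e where u: "unitary_basis N (h t) d e"
    using unitary_basis_exists [OF inner [OF t]] by blast
  show ?thesis
    unfolding Theta_eq_curv [OF inner [OF t] u X Y] kcurv_def
    by (rule curv_frame_cong [OF herm_form_h [OF t] unitary_basis_imp_frame [OF herm_form_h [OF t] u]
        herm_form_k frame_k [OF t] _ X Y])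
      (simp add: h_eq_sigma_metric t k_def)
qed

lemma xyz_deriv:
  assumes t: "t \<in> J"
  shows "(x has_real_derivative real n * (x t)\<^sup>2 + (z t)\<^sup>2) (at t within J)"
    "(y has_real_derivative (real n + 1) * (z t)\<^sup>2) (at t within J)"
    "(z has_real_derivative (real n + 1) / real n * z t * ((real n - 1) * x t + y t)) (at t within J)"
proof -
  have c: "coef0 (Theta N (h t)) = coef0 (kcurv t)" "coef1 (Theta N (h t)) = coef1 (kcurv t)"
    "coef2 (Theta N (h t)) = coef2 (kcurv t)"
    by (simp_all only: coef0_def coef1_def coef2_def Theta_eq_kcurv [OF t] test_sl)
  note d = coef_deriv [OF t, unfolded c coef_kcurv [OF t]]
  \<comment> \<open>The variables are reciprocals of the coefficients, so each curvature coefficient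
    is multiplied by the square of its variable. This turns the quotients of
    \<open>curv_sigma\<close> into polynomials.\<close>
  have inv: "((\<lambda>s. 1 / f s) has_real_derivative c * (1 / f t)\<^sup>2) (at t within J)"
    if "(f has_real_derivative - c) (at t within J)" "0 < f t" for f c
    using DERIV_inverse' [OF that(1)] that(2) by (simp add: divide_inverse power2_eq_square mult_ac)
  note p = xyz_pos [OF t]
  have "((\<lambda>s. 1 / coef0 (h s)) has_real_derivative real n * (x t)\<^sup>2 + (z t)\<^sup>2) (at t within J)"
    using p by (intro DERIV_cong [OF inv [OF d(1) coef_pos(1) [OF t]]]) (simp add: x_def [symmetric] field_simps)
  then show "(x has_real_derivative real n * (x t)\<^sup>2 + (z t)\<^sup>2) (at t within J)"
    by (simp only: x_def [symmetric])
  have "((\<lambda>s. 1 / coef1 (h s)) has_real_derivative (real n + 1) * (z t)\<^sup>2) (at t within J)"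
    using p by (intro DERIV_cong [OF inv [OF d(2) coef_pos(2) [OF t]]]) (simp add: y_def [symmetric])
  then show "(y has_real_derivative (real n + 1) * (z t)\<^sup>2) (at t within J)"
    by (simp only: y_def [symmetric])
  have "((\<lambda>s. 1 / coef2 (h s)) has_real_derivative (real n + 1) / real n * z t * ((real n - 1) * x t + y t)) (at t within J)"
    using p by (intro DERIV_cong [OF inv [OF d(3) coef_pos(3) [OF t]]]) (simp add: z_def [symmetric] power2_eq_square)
  then show "(z has_real_derivative (real n + 1) / real n * z t * ((real n - 1) * x t + y t)) (at t within J)"
    by (simp only: z_def [symmetric])
qed

lemma xyz_init: "x 0 = x0" "y 0 = y0" "z 0 = z0"
  using coef_lincomb [of "h 0" "1 / x0" "1 / y0" "1 / z0"]
  by (simp_all add: x_def y_def z_def init sigma_metric_eq [OF npos])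

lemma xyz_smooth: "smooth_real_on J x" "smooth_real_on J y" "smooth_real_on J z"
proof -
  let ?F = "poly_family {x, y, z}"
  have gen: "x \<in> ?F" "y \<in> ?F" "z \<in> ?F" by (auto intro: poly_family.gen)
  note intros = poly_family.add poly_family.mult poly_family.const gen
  have 1: "(\<lambda>t. real n * (x t * x t) + z t * z t) \<in> ?F" by (intro intros)
  have 2: "(\<lambda>t. (real n + 1) * (z t * z t)) \<in> ?F" by (intro intros)
  have 3: "(\<lambda>t. (real n + 1) / real n * z t * ((real n - 1) * x t + y t)) \<in> ?F" by (intro intros)
  have "\<exists>g\<in>?F. \<forall>t\<in>J. (f has_real_derivative g t) (at t within J)" if "f \<in> {x, y, z}" for f
    using that bexI [OF _ 1, of "\<lambda>g. \<forall>t\<in>J. (x has_real_derivative g t) (at t within J)"]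
      bexI [OF _ 2, of "\<lambda>g. \<forall>t\<in>J. (y has_real_derivative g t) (at t within J)"]
      bexI [OF _ 3, of "\<lambda>g. \<forall>t\<in>J. (z has_real_derivative g t) (at t within J)"]
      xyz_deriv [unfolded power2_eq_square] by auto
  note smooth = smooth_real_on_poly_family [OF this]
  show "smooth_real_on J x" "smooth_real_on J y" "smooth_real_on J z"
    by (intro smooth gen; assumption)+
qed

end

theorem corollary3p2:
  fixes n :: nat and x0 y0 z0 :: real and T :: ereal
    and h :: "real \<Rightarrow> cmat \<Rightarrow> cmat \<Rightarrow> complex"
  assumes "2 \<le> n" and "0 < x0" and "0 < y0" and "0 < z0" and "0 < T"
    and "\<forall>t\<in>{t. 0 \<le> t \<and> ereal t < T}. herm_inner (Suc n) (h t)"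
    and "\<forall>X\<in>sl (Suc n). \<forall>Y\<in>sl (Suc n). h 0 X Y = sigma_metric n x0 y0 z0 X Y"
    and "\<forall>t\<in>{t. 0 \<le> t \<and> ereal t < T}. \<forall>X\<in>sl (Suc n). \<forall>Y\<in>sl (Suc n).
           ((\<lambda>s. h s X Y) has_vector_derivative (- Theta (Suc n) (h t) X Y))
             (at t within {t. 0 \<le> t \<and> ereal t < T})"
  shows "\<exists>x y z :: real \<Rightarrow> real.
     smooth_real_on {t. 0 \<le> t \<and> ereal t < T} x \<and>
     smooth_real_on {t. 0 \<le> t \<and> ereal t < T} y \<and>
     smooth_real_on {t. 0 \<le> t \<and> ereal t < T} z \<and>
     x 0 = x0 \<and> y 0 = y0 \<and> z 0 = z0 \<and>
     (\<forall>t\<in>{t. 0 \<le> t \<and> ereal t < T}.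
        0 < x t \<and> 0 < y t \<and> 0 < z t \<and>
        (x has_real_derivative (real n * (x t)\<^sup>2 + (z t)\<^sup>2))
          (at t within {t. 0 \<le> t \<and> ereal t < T}) \<and>
        (y has_real_derivative ((real n + 1) * (z t)\<^sup>2))
          (at t within {t. 0 \<le> t \<and> ereal t < T}) \<and>
        (z has_real_derivative ((real n + 1) / real n * z t * ((real n - 1) * x t + y t)))
          (at t within {t. 0 \<le> t \<and> ereal t < T}) \<and>
        (\<forall>X\<in>sl (Suc n). \<forall>Y\<in>sl (Suc n). h t X Y = sigma_metric n (x t) (y t) (z t) X Y))"
proof -
  interpret phcf_solution n x0 y0 z0 T h "{t. 0 \<le> t \<and> ereal t < T}"
    using assms by unfold_locales blast+
  show ?thesis
    by (intro exI [of _ x] exI [of _ y] exI [of _ z] conjI ballI xyz_smooth xyz_init xyz_pos xyz_deriv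
        h_eq_sigma_metric)
qed

end
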